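(* Let $X$ and $Y$ be two compact intervals (with non-empty interior) and let $f: X \to X$ and $g: Y \to Y$ be two pc-maps. Then the following properties hold: (1) If $f$ is continuous, then $h_{top}(f)$ coincides with the classical Adler–Konheim–McAndrew (open-cover) topological entropy of $f$. (2) If $A$ is a non-empty, compact subset of $X$ that is $f$-invariant or $f$-pseudo-invariant and satisfies $A\cap\widetilde X_f\neq\emptyset$, then $h_{top}(f|_A) \leq h_{top}(f)$. (3) If $f$ is topologically semi-conjugate (respectively, conjugate) to $g$, then $h_{top}(f)\geq h_{top}(g)$ (respectively, $h_{top}(f) = h_{top}(g)$). (4) $h_{top}(f^k) = k \, h_{top}(f)$ for every integer $k \geq 0$ (by convention, $f^0$ is the identity map). (5) If $X = A_1 \cup \ldots \cup A_p$, where for each $1\le i\le p$ the set $A_i$ is a compact subset of $X$ that is $f$-invariant or $f$-pseudo-invariant and satisfies $A_i \cap \widetilde X_f \neq \emptyset$, then $$h_{top}(f) = \max_{1 \leq i \leq p} h_{top}(f|_{A_i}).$$ (6) Let $\{\mathcal C_k\}_{k \geq 1}$ be a sequence of open covers of $X$ such that $\operatorname{diam}(\mathcal C_k)\to 0$ as $k \to \infty$. If $h_{top}(f) < \infty$, then $\lim_{k \to \infty} h_{top}(f, \mathcal C_k) = h_{top}(f)$; if $h_{top}(f) = \infty$, then $\lim_{k \to \infty} h_{top}(f, \mathcal C_k) = \infty$.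
   Context: **pc-maps.** Let $X\subset\mathbb R$ be a compact interval with non-empty interior, with the topology induced from $\mathbb R$. A pc-map (piecewise continuous interval map) is a map $f:X\to X$ together with finitely many pairwise disjoint non-empty intervals $X_1,\dots,X_N\subset X$ ($N\ge1$), open in $X$ (the continuity pieces), such that $X=\overline{X_1}\cup\dots\cup\overline{X_N}$, each $f|_{X_i}$ is continuous, and $f$ has finitely many critical points (points where $f$ is not locally invertible or where $f$ is discontinuous) within each continuity piece. The pieces are sorted: if $i<j$ then $x<y$ for all $x\in X_i$, $y\in X_j$. Put $\Delta_f:=\bigcup_{i=1}^N\partial X_i$, where $\partial$ is the boundary within $X$. By convention $f$ is continuous at the endpoints of $X$, and these do not belong to $\Delta_f$. For $m\ge 0$ put $\Delta_f^m:=\bigcup_{j=0}^{m-1}f^{-j}(\Delta_f)$ ($\Delta_f^0=\emptyset$), and $\widetilde X_f:=\bigcap_{n\ge0}f^{-n}(X\setminus\Delta_f)$. For $k\ge0$ the iterate $f^k$ is regarded as a pc-map with $\Delta_{f^k}:=\Delta_f^k$ (its continuity pieces are the connected components of $X\setminus\Delta_f^k$; endpoints of $X$ are allowed in $\Delta_{f^k}$). **Invariance.** $A\subset X$ is $f$-invariant if $f(A)\subset A$. It is $f$-pseudo-invariant if for every $x_0\in A$ the limit of $f(x)$ as $x\to x_0$ either from above or from below exists and belongs to $A$ (at least one of the one-sided limits). **Semi-conjugacy.** $f:X\to X$ is topologically semi-conjugate (respectively conjugate) to $g:Y\to Y$ if there is a continuous surjection (respectively homeomorphism) $\varphi:X\to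 Y$ with $\varphi^{-1}(\Delta_g)=\Delta_f$ and $\varphi\circ f=g\circ\varphi$ on $X\setminus\Delta_f$. **Collections and covers.** A collection of $X$ is a set $\mathcal C$ of non-empty subsets of $X$; it is a cover of $A\subset X$ if $\mathcal C\ne\emptyset$ and $A\subset\bigcup_{C\in\mathcal C}C$. An $A$-open cover is a cover of $A$ whose elements are open sets of $A$ (subspace topology); an open cover of $X$ is an $X$-open cover. $\operatorname{diam}(\mathcal C):=\sup_{C\in\mathcal C}\operatorname{diam}(C)$. For collections put $f^{-j}(\mathcal C):=\{f^{-j}(C):C\in\mathcal C\}\setminus\{\emptyset\}$, $\mathcal C\setminus F:=\{C\setminus F:C\in\mathcal C\}\setminus\{\emptyset\}$ for $F\subset X$, $\bigvee_{j}\mathcal C_j:=\{\bigcap_jC_j: C_j\in\mathcal C_j\ \forall j\}\setminus\{\emptyset\}$, and $\mathcal C_f^n:=\bigvee_{j=0}^{n-1}f^{-j}(\mathcal C\setminus\Delta_f)$ for $n\ge1$. **Entropy.** For non-empty $B$ and a cover $\mathcal C$ of $B$, $\aleph_B(\mathcal C)$ is the least cardinality of a sub-collection of $\mathcal C$ covering $B$. For $A\subset X$ compact, $f$-invariant or $f$-pseudo-invariant, with $A\cap\widetilde X_f\ne\emptyset$, and a cover $\mathcal C$ of $A\cap\widetilde X_f$ with $\aleph_{A\cap\widetilde X_f}(\mathcal C)<\infty$ (in particular any $A$-open cover), $$h_{top}(f|_A,\mathcal C):=\lim_{n\to\infty}\frac{\log\aleph_{A\cap\widetilde X_f}(\mathcal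 C_f^n)}{n},\qquad h_{top}(f|_A):=\sup\{h_{top}(f|_A,\mathcal C):\mathcal C\text{ is an }A\text{-open cover}\}.$$ For $A=X$ write $h_{top}(f,\mathcal C)$ and $h_{top}(f)$. *)

theory Defs
  imports "HOL-Analysis.Analysis"
begin

text \<open>
  A pc-map is given by its domain \<open>X\<close>, a function \<open>f\<close> on the reals of which only the
  restriction to \<open>X\<close> matters, and its continuity pieces \<open>P 1, ..., P N\<close>. The entropy depends on
  the pieces only through the set of their boundary points, so the definitions below take that
  set as a parameter \<open>D\<close>. This also covers the iterates of \<open>f\<close>, where \<open>D\<close> may
  contain endpoints of \<open>X\<close>.
\<close>

definition compact_interval :: "real set \<Rightarrow> bool" where
  "compact_interval X \<longleftrightarrow> (\<exists>a b. a < b \<and> X = {a..b})"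

definition locally_invertible_at :: "real set \<Rightarrow> (real \<Rightarrow> real) \<Rightarrow> real \<Rightarrow> bool" where
  "locally_invertible_at X f x \<longleftrightarrow>
     (\<exists>U h. openin (top_of_set X) U \<and> x \<in> U \<and> homeomorphism U (f ` U) f h)"

definition critical_point :: "real set \<Rightarrow> (real \<Rightarrow> real) \<Rightarrow> real \<Rightarrow> bool" where
  "critical_point X f x \<longleftrightarrow>
     \<not> locally_invertible_at X f x \<or> \<not> continuous (at x within X) f"

definition Delta :: "real set \<Rightarrow> nat \<Rightarrow> (nat \<Rightarrow> real set) \<Rightarrow> real set" where
  "Delta X N P = (\<Union>i\<in>{1..N}. top_of_set X frontier_of P i)"

text \<open>
  The last condition is the convention on endpoints. In the presence of the covering condition,
  it forces the endpoints of \<open>X\<close> to lie in the first and the last piece.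
\<close>

definition pc_map ::
  "real set \<Rightarrow> (real \<Rightarrow> real) \<Rightarrow> nat \<Rightarrow> (nat \<Rightarrow> real set) \<Rightarrow> bool" where
  "pc_map X f N P \<longleftrightarrow>
     compact_interval X \<and> f ` X \<subseteq> X \<and> 1 \<le> N \<and>
     (\<forall>i\<in>{1..N}. P i \<noteq> {} \<and> is_interval (P i) \<and> openin (top_of_set X) (P i)) \<and>
     disjoint_family_on P {1..N} \<and>
     X = (\<Union>i\<in>{1..N}. closure (P i)) \<and>
     (\<forall>i\<in>{1..N}. \<forall>j\<in>{1..N}. i < j \<longrightarrow> (\<forall>x\<in>P i. \<forall>y\<in>P j. x < y)) \<and>
     (\<forall>i\<in>{1..N}. continuous_on (P i) f \<and> finite {x \<in> P i. critical_point X f x}) \<and>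
     (\<forall>e\<in>{Inf X, Sup X}. e \<notin> Delta X N P \<and> continuous (at e within X) f)"

definition preimage :: "'a set \<Rightarrow> ('a \<Rightarrow> 'a) \<Rightarrow> nat \<Rightarrow> 'a set \<Rightarrow> 'a set" where
  "preimage X f j S = {x \<in> X. (f ^^ j) x \<in> S}"

definition Delta_iter :: "real set \<Rightarrow> real set \<Rightarrow> (real \<Rightarrow> real) \<Rightarrow> nat \<Rightarrow> real set" where
  "Delta_iter X D f m = (\<Union>j<m. preimage X f j D)"

definition X_tilde :: "real set \<Rightarrow> real set \<Rightarrow> (real \<Rightarrow> real) \<Rightarrow> real set" where
  "X_tilde X D f = (\<Inter>n. preimage X f n (X - D))"

definition invariant_set :: "(real \<Rightarrow> real) \<Rightarrow> real set \<Rightarrow> bool" where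
  "invariant_set f A \<longleftrightarrow> f ` A \<subseteq> A"

text \<open>
  The one-sided limits are taken through points of \<open>X\<close>. There is none from outside at an
  endpoint of \<open>X\<close>, hence the requirement that the filter be non-trivial.
\<close>

definition pseudo_invariant :: "real set \<Rightarrow> (real \<Rightarrow> real) \<Rightarrow> real set \<Rightarrow> bool" where
  "pseudo_invariant X f A \<longleftrightarrow>
     (\<forall>x0\<in>A. \<exists>F\<in>{at x0 within (X \<inter> {x0<..}), at x0 within (X \<inter> {..<x0})}.
        F \<noteq> bot \<and> (\<exists>l\<in>A. (f \<longlongrightarrow> l) F))"

definition semi_conjugate ::
  "real set \<Rightarrow> real set \<Rightarrow> (real \<Rightarrow> real) \<Rightarrow>
   real set \<Rightarrow> real set \<Rightarrow> (real \<Rightarrow> real) \<Rightarrow> bool" where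
  "semi_conjugate X D f Y E g \<longleftrightarrow>
     (\<exists>\<phi>. continuous_on X \<phi> \<and> \<phi> ` X = Y \<and> {x \<in> X. \<phi> x \<in> E} = D \<and>
          (\<forall>x\<in>X - D. \<phi> (f x) = g (\<phi> x)))"

definition conjugate ::
  "real set \<Rightarrow> real set \<Rightarrow> (real \<Rightarrow> real) \<Rightarrow>
   real set \<Rightarrow> real set \<Rightarrow> (real \<Rightarrow> real) \<Rightarrow> bool" where
  "conjugate X D f Y E g \<longleftrightarrow>
     (\<exists>\<phi> \<psi>. homeomorphism X Y \<phi> \<psi> \<and> {x \<in> X. \<phi> x \<in> E} = D \<and>
          (\<forall>x\<in>X - D. \<phi> (f x) = g (\<phi> x)))"

definition open_cover :: "'a::topological_space set \<Rightarrow> 'a set set \<Rightarrow> bool" where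
  "open_cover A \<C> \<longleftrightarrow>
     \<C> \<noteq> {} \<and> (\<forall>C\<in>\<C>. C \<noteq> {} \<and> openin (top_of_set A) C) \<and> A \<subseteq> \<Union>\<C>"

definition cover_diam :: "real set set \<Rightarrow> real" where
  "cover_diam \<C> = (SUP C\<in>\<C>. diameter C)"

definition cover_preimage :: "'a set \<Rightarrow> ('a \<Rightarrow> 'a) \<Rightarrow> nat \<Rightarrow> 'a set set \<Rightarrow> 'a set set" where
  "cover_preimage X f j \<C> = preimage X f j ` \<C> - {{}}"

definition cover_remove :: "'a set set \<Rightarrow> 'a set \<Rightarrow> 'a set set" where
  "cover_remove \<C> F = (\<lambda>C. C - F) ` \<C> - {{}}"

text \<open>Meaningful for \<open>n \<ge> 1\<close> only, since the empty intersection is \<open>UNIV\<close>.\<close>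

definition cover_join :: "nat \<Rightarrow> (nat \<Rightarrow> 'a set set) \<Rightarrow> 'a set set" where
  "cover_join n \<C> = {\<Inter>j<n. C j | C. \<forall>j<n. C j \<in> \<C> j} - {{}}"

definition refined_cover ::
  "real set \<Rightarrow> real set \<Rightarrow> (real \<Rightarrow> real) \<Rightarrow> real set set \<Rightarrow> nat \<Rightarrow> real set set" where
  "refined_cover X D f \<C> n = cover_join n (\<lambda>j. cover_preimage X f j (cover_remove \<C> D))"

text \<open>Meaningful only if some finite sub-collection of \<open>\<C>\<close> covers \<open>B\<close>.\<close>

definition aleph :: "'a set \<Rightarrow> 'a set set \<Rightarrow> nat" where
  "aleph B \<C> = (LEAST m. \<exists>\<S>\<subseteq>\<C>. finite \<S> \<and> card \<S> = m \<and> B \<subseteq> \<Union>\<S>)"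

definition htop_on_cover ::
  "real set \<Rightarrow> real set \<Rightarrow> (real \<Rightarrow> real) \<Rightarrow> real set \<Rightarrow> real set set \<Rightarrow> real" where
  "htop_on_cover X D f A \<C> =
     lim (\<lambda>n. ln (real (aleph (A \<inter> X_tilde X D f) (refined_cover X D f \<C> n))) / real n)"

definition htop_on :: "real set \<Rightarrow> real set \<Rightarrow> (real \<Rightarrow> real) \<Rightarrow> real set \<Rightarrow> ereal" where
  "htop_on X D f A = (SUP \<C>\<in>{\<C>. open_cover A \<C>}. ereal (htop_on_cover X D f A \<C>))"

abbreviation htop_cover ::
  "real set \<Rightarrow> real set \<Rightarrow> (real \<Rightarrow> real) \<Rightarrow> real set set \<Rightarrow> real" where
  "htop_cover X D f \<C> \<equiv> htop_on_cover X D f X \<C>"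

abbreviation htop :: "real set \<Rightarrow> real set \<Rightarrow> (real \<Rightarrow> real) \<Rightarrow> ereal" where
  "htop X D f \<equiv> htop_on X D f X"

text \<open>The classical entropy of Adler, Konheim and McAndrew, for continuous \<open>f\<close> on compact \<open>S\<close>.\<close>

definition akm_entropy_cover ::
  "'a::topological_space set \<Rightarrow> ('a \<Rightarrow> 'a) \<Rightarrow> 'a set set \<Rightarrow> real" where
  "akm_entropy_cover S f \<C> =
     lim (\<lambda>n. ln (real (aleph S (cover_join n (\<lambda>j. cover_preimage S f j \<C>)))) / real n)"

definition akm_entropy :: "'a::topological_space set \<Rightarrow> ('a \<Rightarrow> 'a) \<Rightarrow> ereal" where
  "akm_entropy S f = (SUP \<C>\<in>{\<C>. open_cover S \<C>}. ereal (akm_entropy_cover S f \<C>))"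

definition admissible :: "real set \<Rightarrow> real set \<Rightarrow> (real \<Rightarrow> real) \<Rightarrow> real set \<Rightarrow> bool" where
  "admissible X D f A \<longleftrightarrow>
     compact A \<and> A \<subseteq> X \<and> (invariant_set f A \<or> pseudo_invariant X f A) \<and>
     A \<inter> X_tilde X D f \<noteq> {}"

end

theory Submission
  imports Defs
begin

text \<open>
  Every entropy in the theorem is a growth rate. Fix a set \<open>B\<close> with \<open>f ` B \<subseteq> B\<close> and a cover
  \<open>\<C>\<close>, and count how many words of length \<open>n\<close> over \<open>\<C>\<close> are needed so that every point of \<open>B\<close> follows
  one of them. The counts are submultiplicative, so by Fekete's lemma they have an exponential
  growth rate. For the entropy of a pc-map on \<open>A\<close> the set \<open>B\<close> consists of the regular points of
  \<open>A\<close>, those whose orbit avoids the discontinuities \<open>D\<close>: there the removal of \<open>D\<close> from the cover is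
  invisible, and pseudo-invariant sets are invariant (\<open>htop_on_cover_eq_growth\<close>,
  \<open>admissible_regular_invariant\<close>). For the classical entropy \<open>B\<close> is all of \<open>X\<close>.

  Monotonicity in \<open>A\<close> and under semi-conjugacy then follows by pulling covers back
  (\<open>growth_pullback_le\<close>). The formula for finite unions holds because finitely many pieces multiply the
  counts by at most a constant (\<open>growth_UN_le\<close>). Convergence along covers of vanishing diameter comes
  from a Lebesgue number (\<open>htop_cover_tendsto\<close>). For continuous \<open>f\<close> the regular points are dense, and
  passing to closures of cylinders costs only a slightly finer cover (\<open>growth_dense_le\<close>).

  The formula for iterates is the part where discontinuities matter. The usual proof uses the
  join of the first \<open>k\<close> preimages of \<open>\<C>\<close> as a cover for \<open>f ^^ k\<close>, but this join need not be an open
  cover of \<open>X\<close>. However, a map with finitely many critical points is strictly monotone on a small interval on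
  either side of any point \<open>x\<close>. Hence it has one-sided limits that are approached from one side, and
  so have its iterates. Near \<open>x\<close> three words of length \<open>k\<close> therefore suffice: one for each side and one
  for \<open>x\<close> itself (\<open>itinerary_cover\<close>). This proves \<open>k h(f) \<le> h(f ^^ k) + ln 3\<close> with an error that
  does not depend on \<open>k\<close> (\<open>growth_funpow_ge\<close>), and passing from \<open>k\<close> to \<open>k m\<close> with \<open>m \<rightarrow> \<infinity>\<close> removes the
  error (\<open>htop_funpow\<close>). The same one-sided limits show that fibres are finite, so that all but
  countably many points are regular (\<open>finite_fibre\<close>, \<open>regular_points_dense\<close>).
\<close>

section \<open>Counting elements of a cover\<close>

text \<open>
  The number \<^const>\<open>aleph\<close> is a least natural number and so means nothing when no finite
  sub-collection covers; this predicate is the standing hypothesis that rules this out.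
\<close>

definition has_finite_subcover :: "'a set \<Rightarrow> 'a set set \<Rightarrow> bool" where
  "has_finite_subcover B \<C> \<longleftrightarrow> (\<exists>\<S>\<subseteq>\<C>. finite \<S> \<and> B \<subseteq> \<Union>\<S>)"

lemma aleph_le_card:
  assumes "finite \<S>" "\<S> \<subseteq> \<C>" "B \<subseteq> \<Union>\<S>"
  shows "aleph B \<C> \<le> card \<S>"
  unfolding aleph_def by (rule Least_le) (use assms in auto)

lemma aleph_attained:
  assumes "has_finite_subcover B \<C>"
  obtains \<S> where "finite \<S>" "\<S> \<subseteq> \<C>" "B \<subseteq> \<Union>\<S>" "card \<S> = aleph B \<C>"
proof -
  have "\<exists>\<S>\<subseteq>\<C>. finite \<S> \<and> card \<S> = aleph B \<C> \<and> B \<subseteq> \<Union>\<S>"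
    unfolding aleph_def
    by (rule LeastI_ex) (use assms in \<open>auto simp: has_finite_subcover_def\<close>)
  then show thesis using that by blast
qed

lemma aleph_pos:
  assumes "has_finite_subcover B \<C>" "B \<noteq> {}"
  shows "1 \<le> aleph B \<C>"
proof -
  obtain \<S> where "finite \<S>" "B \<subseteq> \<Union>\<S>" "card \<S> = aleph B \<C>"
    using aleph_attained[OF assms(1)] by metis
  with assms(2) show ?thesis
    by (metis Sup_empty card_0_eq less_one not_le subset_empty)
qed

text \<open>
  Each element of a minimal subcover of \<open>B'\<close> can be replaced by an element of \<open>\<U>\<close> that contains
  its preimage under \<open>h\<close>; elements of \<open>\<V>\<close> that the image of \<open>h\<close> misses are dropped.
  With \<open>h\<close> the identity this compares covers under refinement and under passage to a subset.
\<close>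

lemma has_finite_subcover_pullback:
  assumes "has_finite_subcover B' \<V>" "h ` B \<subseteq> B'"
    and "\<And>V. \<lbrakk>V \<in> \<V>; \<exists>x\<in>B. h x \<in> V\<rbrakk> \<Longrightarrow> \<exists>U\<in>\<U>. \<forall>x\<in>B. h x \<in> V \<longrightarrow> x \<in> U"
  shows "has_finite_subcover B \<U>" "aleph B \<U> \<le> aleph B' \<V>"
proof -
  obtain \<S> where S: "finite \<S>" "\<S> \<subseteq> \<V>" "B' \<subseteq> \<Union>\<S>" "card \<S> = aleph B' \<V>"
    using aleph_attained[OF assms(1)] by metis
  define \<S>' where "\<S>' = {V \<in> \<S>. \<exists>x\<in>B. h x \<in> V}"
  have fin: "finite \<S>'" and le: "card \<S>' \<le> card \<S>"
    using S(1) by (auto simp: \<S>'_def intro: card_mono)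
  have "\<forall>V\<in>\<S>'. \<exists>U\<in>\<U>. \<forall>x\<in>B. h x \<in> V \<longrightarrow> x \<in> U"
    using assms(3) S(2) by (auto simp: \<S>'_def)
  then obtain r where r: "\<And>V. V \<in> \<S>' \<Longrightarrow> r V \<in> \<U>"
      "\<And>V x. \<lbrakk>V \<in> \<S>'; x \<in> B; h x \<in> V\<rbrakk> \<Longrightarrow> x \<in> r V"
    by metis
  have cov: "B \<subseteq> \<Union>(r ` \<S>')"
  proof
    fix x assume "x \<in> B"
    then obtain V where "V \<in> \<S>" "h x \<in> V" using S(3) assms(2) by blast
    then show "x \<in> \<Union>(r ` \<S>')" using r(2) \<open>x \<in> B\<close> by (auto simp: \<S>'_def)
  qed
  have sub: "r ` \<S>' \<subseteq> \<U>" using r(1) by auto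
  show "has_finite_subcover B \<U>"
    unfolding has_finite_subcover_def using cov sub fin by blast
  have "aleph B \<U> \<le> card (r ` \<S>')" using aleph_le_card[OF _ sub cov] fin by simp
  also have "\<dots> \<le> card \<S>'" by (rule card_image_le[OF fin])
  finally show "aleph B \<U> \<le> aleph B' \<V>" using le S(4) by simp
qed

lemma has_finite_subcover_compact:
  assumes "compact A" "open_cover A \<C>" "B \<subseteq> A"
  shows "has_finite_subcover B \<C>"
proof -
  have *: "\<forall>C\<in>\<C>. \<exists>O'. open O' \<and> C = A \<inter> O'"
    using assms(2) by (auto simp: open_cover_def openin_open)
  then obtain w where w: "\<And>C. C \<in> \<C> \<Longrightarrow> open (w C)" "\<And>C. C \<in> \<C> \<Longrightarrow> C = A \<inter> w C"
    by metis
  have "A \<subseteq> \<Union>\<C>" using assms(2) by (simp add: open_cover_def)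
  then have "A \<subseteq> (\<Union>C\<in>\<C>. w C)" using w(2) by blast
  then obtain \<S> where "\<S> \<subseteq> \<C>" "finite \<S>" "A \<subseteq> (\<Union>C\<in>\<S>. w C)"
    using compactE_image[OF assms(1), of \<C> w] w(1) by metis
  then have "B \<subseteq> \<Union>\<S>" using w(2) assms(3) by blast
  with \<open>\<S> \<subseteq> \<C>\<close> \<open>finite \<S>\<close> show ?thesis unfolding has_finite_subcover_def by blast
qed

section \<open>Cylinders and the growth rate of their number\<close>

text \<open>
  The points of \<open>B\<close> whose orbit follows the word \<open>c\<close> during the first \<open>n\<close> steps. These sets are the
  elements of the iterated join of a cover; the empty ones are kept, because they never
  occur in a minimal subcover.
\<close>

definition cylinder :: "'a set \<Rightarrow> ('a \<Rightarrow> 'a) \<Rightarrow> (nat \<Rightarrow> 'a set) \<Rightarrow> nat \<Rightarrow> 'a set" where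
  "cylinder B f c n = {x \<in> B. \<forall>j<n. (f ^^ j) x \<in> c j}"

definition cylinders :: "'a set \<Rightarrow> ('a \<Rightarrow> 'a) \<Rightarrow> 'a set set \<Rightarrow> nat \<Rightarrow> 'a set set" where
  "cylinders B f \<C> n = {cylinder B f c n | c. \<forall>j<n. c j \<in> \<C>}"

definition cyl_count :: "'a set \<Rightarrow> ('a \<Rightarrow> 'a) \<Rightarrow> 'a set set \<Rightarrow> nat \<Rightarrow> nat" where
  "cyl_count B f \<C> n = aleph B (cylinders B f \<C> n)"

text \<open>
  Exponential growth rate of the number of words of length \<open>n\<close> that are needed to describe all
  orbits in \<open>B\<close>. Both the entropy of a pc-map and the classical entropy of a continuous map
  relative to a cover have this form.
\<close>

definition growth :: "'a set \<Rightarrow> ('a \<Rightarrow> 'a) \<Rightarrow> 'a set set \<Rightarrow> real" where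
  "growth B f \<C> = lim (\<lambda>n. ln (real (cyl_count B f \<C> n)) / real n)"

lemma funpow_mem: "f ` B \<subseteq> B \<Longrightarrow> x \<in> B \<Longrightarrow> (f ^^ n) x \<in> B"
  by (induction n) auto

lemma has_finite_subcover_cylinders:
  assumes "has_finite_subcover B \<C>" "f ` B \<subseteq> B"
  shows "has_finite_subcover B (cylinders B f \<C> n)"
proof -
  obtain \<S> where S: "\<S> \<subseteq> \<C>" "finite \<S>" "B \<subseteq> \<Union>\<S>"
    using assms(1) unfolding has_finite_subcover_def by blast
  let ?T = "(\<lambda>c. cylinder B f c n) ` (PiE {..<n} (\<lambda>_. \<S>))"
  have "finite ?T" using S(2) by (intro finite_imageI finite_PiE) auto
  moreover have "?T \<subseteq> cylinders B f \<C> n"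
    using S(1) by (force simp: cylinders_def PiE_def Pi_def)
  moreover have "B \<subseteq> \<Union>?T"
  proof
    fix x assume x: "x \<in> B"
    have "\<forall>j. \<exists>C\<in>\<S>. (f ^^ j) x \<in> C" using funpow_mem[OF assms(2) x] S(3) by blast
    then obtain c where c: "\<And>j. c j \<in> \<S>" "\<And>j. (f ^^ j) x \<in> c j" by metis
    have "x \<in> cylinder B f (restrict c {..<n}) n" using x c by (auto simp: cylinder_def)
    moreover have "restrict c {..<n} \<in> PiE {..<n} (\<lambda>_. \<S>)" using c by auto
    ultimately show "x \<in> \<Union>?T" by blast
  qed
  ultimately show ?thesis unfolding has_finite_subcover_def by blast
qed

lemma cyl_count_pos:
  assumes "has_finite_subcover B \<C>" "f ` B \<subseteq> B" "B \<noteq> {}"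
  shows "1 \<le> cyl_count B f \<C> n"
  unfolding cyl_count_def
  by (intro aleph_pos has_finite_subcover_cylinders assms)

text \<open>
  A word for the first \<open>p\<close> steps followed by a word for the next \<open>q\<close> steps, started at the
  \<open>p\<close>-th image, is a word of length \<open>p + q\<close>.
\<close>

lemma cyl_count_submultiplicative:
  assumes "has_finite_subcover B \<C>" "f ` B \<subseteq> B"
  shows "cyl_count B f \<C> (p + q) \<le> cyl_count B f \<C> p * cyl_count B f \<C> q"
proof -
  obtain \<S> where S: "finite \<S>" "\<S> \<subseteq> cylinders B f \<C> p" "B \<subseteq> \<Union>\<S>" "card \<S> = cyl_count B f \<C> p"
    using aleph_attained[OF has_finite_subcover_cylinders[OF assms]] unfolding cyl_count_def
    by metis
  obtain \<T> where T: "finite \<T>" "\<T> \<subseteq> cylinders B f \<C> q" "B \<subseteq> \<Union>\<T>" "card \<T> = cyl_count B f \<C> q"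
    using aleph_attained[OF has_finite_subcover_cylinders[OF assms]] unfolding cyl_count_def
    by metis
  let ?F = "\<lambda>(V, W). {x \<in> V. (f ^^ p) x \<in> W}"
  have sub: "?F ` (\<S> \<times> \<T>) \<subseteq> cylinders B f \<C> (p + q)"
  proof (safe)
    fix V W assume "V \<in> \<S>" "W \<in> \<T>"
    then obtain c d where c: "V = cylinder B f c p" "\<forall>j<p. c j \<in> \<C>"
        and d: "W = cylinder B f d q" "\<forall>j<q. d j \<in> \<C>"
      using S(2) T(2) unfolding cylinders_def by blast
    let ?e = "\<lambda>j. if j < p then c j else d (j - p)"
    have "{x \<in> V. (f ^^ p) x \<in> W} = cylinder B f ?e (p + q)"
    proof (rule set_eqI)
      fix x
      have "(\<forall>j<q. (f ^^ j) ((f ^^ p) x) \<in> d j) \<longleftrightarrow> (\<forall>j<p + q. \<not> j < p \<longrightarrow> (f ^^ j) x \<in> d (j - p))"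
      proof (intro iffI allI impI)
        fix j assume a: "\<forall>j<q. (f ^^ j) ((f ^^ p) x) \<in> d j" "j < p + q" "\<not> j < p"
        then have "(f ^^ (j - p)) ((f ^^ p) x) \<in> d (j - p)" by auto
        moreover have "(f ^^ (j - p)) ((f ^^ p) x) = (f ^^ ((j - p) + p)) x"
          by (simp only: funpow_add o_def)
        ultimately show "(f ^^ j) x \<in> d (j - p)" using a(3) by simp
      next
        fix j assume a: "\<forall>j<p + q. \<not> j < p \<longrightarrow> (f ^^ j) x \<in> d (j - p)" "j < q"
        then have "(f ^^ (j + p)) x \<in> d j" by (metis add.commute add_diff_cancel_left' nat_add_left_cancel_less not_add_less1)
        then show "(f ^^ j) ((f ^^ p) x) \<in> d j" by (simp add: funpow_add)
      qed
      then show "x \<in> {x \<in> V. (f ^^ p) x \<in> W} \<longleftrightarrow> x \<in> cylinder B f ?e (p + q)"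
        unfolding c(1) d(1) cylinder_def
        using funpow_mem[OF assms(2)] by auto
    qed
    moreover have "\<forall>j<p + q. ?e j \<in> \<C>" using c(2) d(2) by auto
    ultimately show "{x \<in> V. (f ^^ p) x \<in> W} \<in> cylinders B f \<C> (p + q)"
      unfolding cylinders_def by blast
  qed
  have cov: "B \<subseteq> \<Union>(?F ` (\<S> \<times> \<T>))"
  proof
    fix x assume x: "x \<in> B"
    obtain V where "V \<in> \<S>" "x \<in> V" using x S(3) by blast
    moreover obtain W where "W \<in> \<T>" "(f ^^ p) x \<in> W" using funpow_mem[OF assms(2) x] T(3) by blast
    ultimately show "x \<in> \<Union>(?F ` (\<S> \<times> \<T>))" by auto
  qed
  have "cyl_count B f \<C> (p + q) \<le> card (?F ` (\<S> \<times> \<T>))"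
    unfolding cyl_count_def by (rule aleph_le_card[OF _ sub cov]) (use S T in auto)
  also have "\<dots> \<le> card (\<S> \<times> \<T>)" by (rule card_image_le) (use S T in auto)
  finally show ?thesis using S(4) T(4) by (simp add: card_cartesian_product)
qed

text \<open>
  Fekete's lemma. Division with remainder by a fixed \<open>m\<close> bounds \<open>a n / n\<close> by \<open>a m / m\<close> up to an
  error of order \<open>1 / n\<close>, so the sequence converges to its infimum.
\<close>

lemma fekete_nonneg:
  fixes a :: "nat \<Rightarrow> real"
  assumes nn: "\<And>n. 0 \<le> a n" and sub: "\<And>p q. a (p + q) \<le> a p + a q"
  shows "convergent (\<lambda>n. a n / real n)"
proof -
  define L where "L = (INF n\<in>{1..}. a n / real n)"
  have bdd: "bdd_below ((\<lambda>n. a n / real n) ` {1..})"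
    by (rule bdd_belowI[of _ 0]) (auto simp: nn)
  have mult: "a (q * m) \<le> real q * a m" if "q \<ge> 1" for q m
    using that
  proof (induction q rule: dec_induct)
    case (step q)
    then show ?case using sub[of m "q * m"] by (simp add: algebra_simps)
  qed simp
  have "(\<lambda>n. a n / real n) \<longlonglongrightarrow> L"
  proof (rule order_tendstoI)
    fix l assume l: "l < L"
    have "\<forall>\<^sub>F n in sequentially. L \<le> a n / real n"
      using eventually_ge_at_top[of 1]
      by eventually_elim (unfold L_def, rule cINF_lower[OF bdd], simp)
    then show "\<forall>\<^sub>F n in sequentially. l < a n / real n"
      by eventually_elim (use l in auto)
  next
    fix u assume u: "L < u"
    obtain m where m: "m \<ge> 1" "a m / real m < u"
      using u cINF_less_iff[OF _ bdd, of u] by (auto simp: L_def)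
    define K where "K = Max (a ` {..<m})"
    have K: "a r \<le> K" if "r < m" for r
      unfolding K_def using that by (intro Max_ge) auto
    have K0: "0 \<le> K" using K[of 0] nn[of 0] m(1) by simp
    have bound: "a n / real n \<le> a m / real m + (a m + K) / real n" if n: "n \<ge> 1" for n
    proof -
      have "a n \<le> real (n div m) * a m + a m + K"
      proof (cases "n div m \<ge> 1")
        case True
        have "a n = a ((n div m) * m + n mod m)" by simp
        also have "\<dots> \<le> a ((n div m) * m) + a (n mod m)" by (rule sub)
        also have "\<dots> \<le> real (n div m) * a m + K"
          using mult[OF True, of m] K[of "n mod m"] m(1) by simp
        finally show ?thesis using nn[of m] by simp
      next
        case False
        then have "n < m" using m(1) by (metis div_greater_zero_iff less_eq_Suc_le not_le One_nat_def)
        then show ?thesis using K[of n] nn[of m] by simp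
      qed
      moreover have "real (n div m) * a m \<le> real n / real m * a m"
        by (intro mult_right_mono of_nat_div_le_of_nat nn)
      ultimately have "a n \<le> real n / real m * a m + (a m + K)" by linarith
      then have "a n / real n \<le> (real n / real m * a m + (a m + K)) / real n"
        by (rule divide_right_mono) simp
      also have "\<dots> = a m / real m + (a m + K) / real n"
        using n by (simp add: field_simps)
      finally show ?thesis .
    qed
    have "(\<lambda>n. a m / real m + (a m + K) / real n) \<longlonglongrightarrow> a m / real m + 0"
      by (intro tendsto_add tendsto_const lim_const_over_n)
    then have "\<forall>\<^sub>F n in sequentially. a m / real m + (a m + K) / real n < u"
      using m(2) by (intro order_tendstoD) auto
    then show "\<forall>\<^sub>F n in sequentially. a n / real n < u"
      using eventually_ge_at_top[of 1]
      by eventually_elim (use bound in fastforce)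
  qed
  then show ?thesis by (auto simp: convergent_def)
qed

text \<open>
  The entropies are defined through \<^const>\<open>lim\<close>, which carries information only for convergent
  sequences. All later comparisons of entropies rest on this convergence.
\<close>

lemma growth_tendsto:
  assumes "has_finite_subcover B \<C>" "f ` B \<subseteq> B" "B \<noteq> {}"
  shows "(\<lambda>n. ln (real (cyl_count B f \<C> n)) / real n) \<longlonglongrightarrow> growth B f \<C>"
proof -
  have pos: "1 \<le> real (cyl_count B f \<C> n)" for n
    using cyl_count_pos[OF assms, of n] by simp
  have "convergent (\<lambda>n. ln (real (cyl_count B f \<C> n)) / real n)"
  proof (rule fekete_nonneg)
    show "0 \<le> ln (real (cyl_count B f \<C> n))" for n using pos[of n] by simp
    fix p q
    have "real (cyl_count B f \<C> (p + q)) \<le> real (cyl_count B f \<C> p) * real (cyl_count B f \<C> q)"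
      using cyl_count_submultiplicative[OF assms(1,2), of p q] by (metis of_nat_le_iff of_nat_mult)
    then have "ln (real (cyl_count B f \<C> (p + q)))
        \<le> ln (real (cyl_count B f \<C> p) * real (cyl_count B f \<C> q))"
      using pos[of "p + q"] by (intro ln_mono) auto
    also have "\<dots> = ln (real (cyl_count B f \<C> p)) + ln (real (cyl_count B f \<C> q))"
      using pos[of p] pos[of q] by (intro ln_mult_pos) auto
    finally show "ln (real (cyl_count B f \<C> (p + q)))
        \<le> ln (real (cyl_count B f \<C> p)) + ln (real (cyl_count B f \<C> q))" .
  qed
  then show ?thesis unfolding growth_def by (simp add: convergent_LIMSEQ_iff)
qed

lemma growth_nonneg:
  assumes "has_finite_subcover B \<C>" "f ` B \<subseteq> B" "B \<noteq> {}"
  shows "0 \<le> growth B f \<C>"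
  by (rule LIMSEQ_le_const[OF growth_tendsto[OF assms]])
     (use cyl_count_pos[OF assms] in \<open>auto intro!: exI[of _ 0] divide_nonneg_nonneg ln_ge_zero
        simp: real_of_nat_ge_one_iff\<close>)

lemma growth_tendsto_multiples:
  assumes "has_finite_subcover B \<C>" "f ` B \<subseteq> B" "B \<noteq> {}" "k \<ge> 1"
  shows "(\<lambda>n. ln (real (cyl_count B f \<C> (k * n))) / real n) \<longlonglongrightarrow> real k * growth B f \<C>"
proof -
  have "strict_mono (\<lambda>n. k * n)" using assms(4) by (auto simp: strict_mono_def)
  from LIMSEQ_subseq_LIMSEQ[OF growth_tendsto[OF assms(1-3)] this]
  have "(\<lambda>n. real k * (ln (real (cyl_count B f \<C> (k * n))) / real (k * n)))
      \<longlonglongrightarrow> real k * growth B f \<C>"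
    by (intro tendsto_mult tendsto_const) (simp add: o_def)
  moreover have "real k * (ln (real (cyl_count B f \<C> (k * n))) / real (k * n))
      = ln (real (cyl_count B f \<C> (k * n))) / real n" for n
    using assms(4) by simp
  ultimately show ?thesis by simp
qed

section \<open>Comparing growth rates\<close>

lemma ln_of_nat_mono: "1 \<le> m \<Longrightarrow> m \<le> n \<Longrightarrow> ln (real m) \<le> ln (real n)"
  by (intro ln_mono) auto

lemma growth_le_of_cyl_count_le:
  assumes "has_finite_subcover B \<U>" "f ` B \<subseteq> B" "B \<noteq> {}"
    and "has_finite_subcover B' \<V>" "f' ` B' \<subseteq> B'" "B' \<noteq> {}"
    and le: "\<And>n. cyl_count B f \<U> n \<le> cyl_count B' f' \<V> n"
  shows "growth B f \<U> \<le> growth B' f' \<V>"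
proof (rule LIMSEQ_le[OF growth_tendsto[OF assms(1-3)] growth_tendsto[OF assms(4-6)]])
  show "\<exists>N. \<forall>n\<ge>N. ln (real (cyl_count B f \<U> n)) / real n \<le> ln (real (cyl_count B' f' \<V> n)) / real n"
    using le cyl_count_pos[OF assms(1-3)]
    by (intro exI[of _ 0] allI impI divide_right_mono ln_of_nat_mono) auto
qed

text \<open>
  An itinerary of \<open>h x\<close> determines an itinerary of \<open>x\<close>, letter by letter, so words for \<open>f'\<close>
  translate into words for \<open>f\<close>. The assumption speaks of orbits instead of commutation with \<open>h\<close>
  so that it applies to an arbitrary section of a semi-conjugacy.
\<close>

lemma growth_pullback_le:
  assumes fin: "has_finite_subcover B' \<V>" and inv: "f ` B \<subseteq> B" "f' ` B' \<subseteq> B'"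
    and h: "h ` B \<subseteq> B'" and ne: "B \<noteq> {}"
    and ref: "\<And>V. \<lbrakk>V \<in> \<V>; \<exists>x\<in>B. \<exists>j. (f' ^^ j) (h x) \<in> V\<rbrakk>
      \<Longrightarrow> \<exists>U\<in>\<U>. \<forall>x\<in>B. \<forall>j. (f' ^^ j) (h x) \<in> V \<longrightarrow> (f ^^ j) x \<in> U"
  shows "growth B f \<U> \<le> growth B' f' \<V>"
proof (rule growth_le_of_cyl_count_le)
  show "has_finite_subcover B \<U>"
  proof (rule has_finite_subcover_pullback(1)[OF fin h])
    fix V assume "V \<in> \<V>" "\<exists>x\<in>B. h x \<in> V"
    then obtain U where U: "U \<in> \<U>" "\<forall>x\<in>B. \<forall>j. (f' ^^ j) (h x) \<in> V \<longrightarrow> (f ^^ j) x \<in> U"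
      using ref[of V] by (metis funpow_0)
    from U(2) have "\<forall>x\<in>B. h x \<in> V \<longrightarrow> x \<in> U" by (metis funpow_0)
    with U(1) show "\<exists>U\<in>\<U>. \<forall>x\<in>B. h x \<in> V \<longrightarrow> x \<in> U" by blast
  qed
  show "B' \<noteq> {}" using ne h by auto
  show "cyl_count B f \<U> n \<le> cyl_count B' f' \<V> n" for n
    unfolding cyl_count_def
  proof (rule has_finite_subcover_pullback(2)[OF has_finite_subcover_cylinders[OF fin inv(2)] h])
    fix V assume "V \<in> cylinders B' f' \<V> n" "\<exists>x\<in>B. h x \<in> V"
    then obtain c x0 where c: "V = cylinder B' f' c n" "\<forall>j<n. c j \<in> \<V>" and x0: "x0 \<in> B" "h x0 \<in> V"
      unfolding cylinders_def by blast
    have "\<exists>U\<in>\<U>. \<forall>x\<in>B. \<forall>i. (f' ^^ i) (h x) \<in> c j \<longrightarrow> (f ^^ i) x \<in> U" if j: "j < n" for j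
    proof (rule ref)
      have "(f' ^^ j) (h x0) \<in> c j" using j x0(2) by (auto simp: c(1) cylinder_def)
      then show "\<exists>x\<in>B. \<exists>i. (f' ^^ i) (h x) \<in> c j" using x0(1) by blast
    qed (use j c in auto)
    then obtain d where d: "\<And>j. j < n \<Longrightarrow> d j \<in> \<U>"
        "\<And>i j x. \<lbrakk>j < n; x \<in> B; (f' ^^ i) (h x) \<in> c j\<rbrakk> \<Longrightarrow> (f ^^ i) x \<in> d j"
      by metis
    have "cylinder B f d n \<in> cylinders B f \<U> n" using d(1) by (auto simp: cylinders_def)
    moreover have "\<forall>x\<in>B. h x \<in> V \<longrightarrow> x \<in> cylinder B f d n"
      using d(2) by (auto simp: c(1) cylinder_def)
    ultimately show "\<exists>U\<in>cylinders B f \<U> n. \<forall>x\<in>B. h x \<in> V \<longrightarrow> x \<in> U" by blast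
  qed
qed (use assms in auto)

lemma growth_refine_le:
  assumes "has_finite_subcover B' \<V>" "f ` B \<subseteq> B" "f ` B' \<subseteq> B'" "B \<subseteq> B'" "B \<noteq> {}"
    and ref: "\<And>V. V \<in> \<V> \<Longrightarrow> V \<inter> B \<noteq> {} \<Longrightarrow> \<exists>U\<in>\<U>. V \<inter> B \<subseteq> U"
  shows "growth B f \<U> \<le> growth B' f \<V>"
proof (rule growth_pullback_le[where h = "\<lambda>x. x"])
  fix V assume V: "V \<in> \<V>" "\<exists>x\<in>B. \<exists>j. (f ^^ j) x \<in> V"
  then have "V \<inter> B \<noteq> {}" using funpow_mem[OF assms(2)] by blast
  then obtain U where "U \<in> \<U>" "V \<inter> B \<subseteq> U" using ref[OF V(1)] by blast
  then show "\<exists>U\<in>\<U>. \<forall>x\<in>B. \<forall>j. (f ^^ j) x \<in> V \<longrightarrow> (f ^^ j) x \<in> U"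
    using funpow_mem[OF assms(2)] by blast
qed (use assms in auto)

lemma aleph_UN_le:
  assumes "finite I" "\<And>i. i \<in> I \<Longrightarrow> has_finite_subcover (B i) \<C>"
  shows "aleph (\<Union>i\<in>I. B i) \<C> \<le> (\<Sum>i\<in>I. aleph (B i) \<C>)"
proof -
  have "\<forall>i\<in>I. \<exists>\<S>. finite \<S> \<and> \<S> \<subseteq> \<C> \<and> B i \<subseteq> \<Union>\<S> \<and> card \<S> = aleph (B i) \<C>"
    using aleph_attained[OF assms(2)] by metis
  then obtain \<S> where S: "\<And>i. i \<in> I \<Longrightarrow> finite (\<S> i)" "\<And>i. i \<in> I \<Longrightarrow> \<S> i \<subseteq> \<C>"
      "\<And>i. i \<in> I \<Longrightarrow> B i \<subseteq> \<Union>(\<S> i)" "\<And>i. i \<in> I \<Longrightarrow> card (\<S> i) = aleph (B i) \<C>"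
    by metis
  have "aleph (\<Union>i\<in>I. B i) \<C> \<le> card (\<Union>i\<in>I. \<S> i)"
  proof (rule aleph_le_card)
    show "finite (\<Union>i\<in>I. \<S> i)" using assms(1) S(1) by blast
    show "(\<Union>i\<in>I. \<S> i) \<subseteq> \<C>" using S(2) by blast
    show "(\<Union>i\<in>I. B i) \<subseteq> \<Union>(\<Union>i\<in>I. \<S> i)"
    proof
      fix x assume "x \<in> (\<Union>i\<in>I. B i)"
      then obtain i where "i \<in> I" "x \<in> B i" by blast
      then show "x \<in> \<Union>(\<Union>i\<in>I. \<S> i)" using S(3)[of i] by blast
    qed
  qed
  also have "\<dots> \<le> (\<Sum>i\<in>I. card (\<S> i))" by (rule card_UN_le[OF assms(1)])
  also have "\<dots> = (\<Sum>i\<in>I. aleph (B i) \<C>)" by (rule sum.cong) (auto simp: S(4))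
  finally show ?thesis .
qed

text \<open>
  If each of finitely many invariant pieces needs at most about \<open>exp (n M)\<close> words, then the union
  needs at most \<open>card I\<close> times as many, and a constant factor does not change the growth rate.
\<close>

lemma growth_UN_le:
  assumes I: "finite I" "I \<noteq> {}" and fin: "has_finite_subcover B \<C>"
    and B: "B = (\<Union>i\<in>I. B' i)"
    and inv: "\<And>i. i \<in> I \<Longrightarrow> f ` B' i \<subseteq> B' i" and ne: "\<And>i. i \<in> I \<Longrightarrow> B' i \<noteq> {}"
    and M: "\<And>i. i \<in> I \<Longrightarrow> growth (B' i) f \<C> \<le> M"
  shows "growth B f \<C> \<le> M"
proof (rule field_le_epsilon)
  fix e :: real assume e: "0 < e"
  have sub: "B' i \<subseteq> B" if "i \<in> I" for i using B that by auto
  have invB: "f ` B \<subseteq> B" using inv unfolding B by blast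
  have neB: "B \<noteq> {}" using I(2) ne B by auto
  have fin': "has_finite_subcover (B' i) \<C>" if "i \<in> I" for i
    by (rule has_finite_subcover_pullback(1)[OF fin, of "\<lambda>x. x"]) (use sub[OF that] in blast)+
  have count: "cyl_count B f \<C> n \<le> (\<Sum>i\<in>I. cyl_count (B' i) f \<C> n)" for n
  proof -
    have *: "has_finite_subcover (B' i) (cylinders B f \<C> n)
        \<and> aleph (B' i) (cylinders B f \<C> n) \<le> cyl_count (B' i) f \<C> n" if i: "i \<in> I" for i
    proof -
      have **: "\<exists>U\<in>cylinders B f \<C> n. \<forall>x\<in>B' i. x \<in> V \<longrightarrow> x \<in> U"
        if V: "V \<in> cylinders (B' i) f \<C> n" for V
      proof -
        obtain c where "V = cylinder (B' i) f c n" "\<forall>j<n. c j \<in> \<C>"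
          using V unfolding cylinders_def by blast
        then show ?thesis
          using sub[OF i] by (intro bexI[of _ "cylinder B f c n"]) (auto simp: cylinders_def cylinder_def)
      qed
      show ?thesis unfolding cyl_count_def
        using has_finite_subcover_pullback[OF has_finite_subcover_cylinders[OF fin'[OF i] inv[OF i], of n],
            of "\<lambda>x. x" "B' i" "cylinders B f \<C> n"] ** by auto
    qed
    have "cyl_count B f \<C> n \<le> (\<Sum>i\<in>I. aleph (B' i) (cylinders B f \<C> n))"
      unfolding cyl_count_def
      using aleph_UN_le[OF I(1), of B' "cylinders B f \<C> n"] * unfolding B[symmetric] by blast
    also have "\<dots> \<le> (\<Sum>i\<in>I. cyl_count (B' i) f \<C> n)" by (rule sum_mono) (use * in auto)
    finally show ?thesis .
  qed
  have "\<forall>\<^sub>F n in sequentially. \<forall>i\<in>I. ln (real (cyl_count (B' i) f \<C> n)) / real n < M + e"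
  proof (intro eventually_ball_finite[OF I(1)] ballI)
    fix i assume i: "i \<in> I"
    show "\<forall>\<^sub>F n in sequentially. ln (real (cyl_count (B' i) f \<C> n)) / real n < M + e"
      by (rule order_tendstoD(2)[OF growth_tendsto[OF fin'[OF i] inv[OF i] ne[OF i]]])
         (use M[OF i] e in linarith)
  qed
  then have ev: "\<forall>\<^sub>F n in sequentially. ln (real (cyl_count B f \<C> n)) / real n
      \<le> ln (real (card I)) / real n + (M + e)"
    using eventually_ge_at_top[of 1]
  proof eventually_elim
    case (elim n)
    have "real (cyl_count (B' i) f \<C> n) \<le> exp (real n * (M + e))" if "i \<in> I" for i
    proof -
      have pos: "0 < real (cyl_count (B' i) f \<C> n)"
        using cyl_count_pos[OF fin'[OF that] inv[OF that] ne[OF that], of n] by simp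
      have "ln (real (cyl_count (B' i) f \<C> n)) \<le> real n * (M + e)"
        using elim(1)[rule_format, OF that] elim(2) by (simp add: field_simps)
      then show ?thesis using pos by (metis exp_le_cancel_iff exp_ln)
    qed
    then have "(\<Sum>i\<in>I. real (cyl_count (B' i) f \<C> n)) \<le> real (card I) * exp (real n * (M + e))"
      by (rule sum_bounded_above)
    moreover have "real (cyl_count B f \<C> n) \<le> (\<Sum>i\<in>I. real (cyl_count (B' i) f \<C> n))"
      using count[of n] unfolding of_nat_sum[symmetric] by (rule of_nat_mono)
    ultimately have "ln (real (cyl_count B f \<C> n)) \<le> ln (real (card I) * exp (real n * (M + e)))"
      using cyl_count_pos[OF fin invB neB, of n] by (intro ln_mono) auto
    also have "\<dots> = ln (real (card I)) + real n * (M + e)"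
      using I by (subst ln_mult_pos) (auto simp: card_gt_0_iff)
    finally have "ln (real (cyl_count B f \<C> n)) / real n
        \<le> (ln (real (card I)) + real n * (M + e)) / real n"
      by (rule divide_right_mono) simp
    then show ?case using elim(2) by (simp add: add_divide_distrib)
  qed
  have "(\<lambda>n. ln (real (card I)) / real n + (M + e)) \<longlonglongrightarrow> 0 + (M + e)"
    by (intro tendsto_add tendsto_const lim_const_over_n)
  from tendsto_le[OF _ this growth_tendsto[OF fin invB neB] ev]
  show "growth B f \<C> \<le> M + e" by simp
qed

text \<open>
  A word for \<open>f\<close> of length \<open>k n\<close> gives a word for \<open>f ^^ k\<close> of length \<open>n\<close> by reading every \<open>k\<close>-th letter.
\<close>

lemma growth_funpow_le:
  assumes fin: "has_finite_subcover B \<C>" and inv: "f ` B \<subseteq> B" and ne: "B \<noteq> {}" and k: "k \<ge> 1"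
  shows "growth B (f ^^ k) \<C> \<le> real k * growth B f \<C>"
proof -
  have inv': "(f ^^ k) ` B \<subseteq> B" using funpow_mem[OF inv] by auto
  have le: "cyl_count B (f ^^ k) \<C> n \<le> cyl_count B f \<C> (k * n)" for n
    unfolding cyl_count_def
  proof (rule has_finite_subcover_pullback(2)[OF has_finite_subcover_cylinders[OF fin inv], of "\<lambda>x. x"])
    fix V assume "V \<in> cylinders B f \<C> (k * n)"
    then obtain c where c: "V = cylinder B f c (k * n)" "\<forall>j<k * n. c j \<in> \<C>"
      unfolding cylinders_def by blast
    let ?d = "\<lambda>j. c (k * j)"
    have "cylinder B (f ^^ k) ?d n \<in> cylinders B (f ^^ k) \<C> n"
      using c(2) k by (auto simp: cylinders_def)
    moreover have "\<forall>x\<in>B. x \<in> V \<longrightarrow> x \<in> cylinder B (f ^^ k) ?d n"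
      using k by (auto simp: c(1) cylinder_def funpow_mult mult.commute)
    ultimately show "\<exists>U\<in>cylinders B (f ^^ k) \<C> n. \<forall>x\<in>B. x \<in> V \<longrightarrow> x \<in> U" by blast
  qed auto
  show ?thesis
  proof (rule LIMSEQ_le[OF growth_tendsto[OF fin inv' ne] growth_tendsto_multiples[OF fin inv ne k]])
    show "\<exists>N. \<forall>n\<ge>N. ln (real (cyl_count B (f ^^ k) \<C> n)) / real n
        \<le> ln (real (cyl_count B f \<C> (k * n))) / real n"
      using le cyl_count_pos[OF fin inv' ne]
      by (intro exI[of _ 0] allI impI divide_right_mono ln_of_nat_mono) auto
  qed
qed

text \<open>
  Suppose that, for \<open>y\<close> in a given element of \<open>\<U>\<close>, one of \<open>card I\<close> words describes the next \<open>k\<close> steps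
  of the orbit under \<open>f\<close>. Then the orbits that follow a word of length \<open>n\<close> for \<open>f ^^ k\<close> and \<open>\<U>\<close> are described by at most
  \<open>card I ^ n\<close> words of length \<open>k n\<close> for \<open>f\<close> and \<open>\<C>\<close>. The loss \<open>ln (card I)\<close> does not depend on \<open>k\<close>;
  this makes it negligible once \<open>k\<close> is replaced by large multiples of itself.
\<close>

lemma growth_funpow_ge:
  fixes w :: "'a set \<Rightarrow> 's \<Rightarrow> nat \<Rightarrow> 'a set"
  assumes finU: "has_finite_subcover B \<U>" and finC: "has_finite_subcover B \<C>"
    and inv: "f ` B \<subseteq> B" and ne: "B \<noteq> {}" and k: "k \<ge> 1"
    and I: "finite I"
    and w: "\<And>U s i. \<lbrakk>U \<in> \<U>; s \<in> I; i < k\<rbrakk> \<Longrightarrow> w U s i \<in> \<C>"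
    and cov: "\<And>U y. \<lbrakk>U \<in> \<U>; y \<in> U; y \<in> B\<rbrakk> \<Longrightarrow> \<exists>s\<in>I. \<forall>i<k. (f ^^ i) y \<in> w U s i"
  shows "real k * growth B f \<C> \<le> growth B (f ^^ k) \<U> + ln (real (card I))"
proof -
  have inv': "(f ^^ k) ` B \<subseteq> B" using funpow_mem[OF inv] by auto
  have I0: "card I > 0"
  proof -
    obtain y where "y \<in> B" using ne by auto
    then obtain U where "U \<in> \<U>" "y \<in> U" using finU by (force simp: has_finite_subcover_def)
    then show ?thesis using cov[of U y] \<open>y \<in> B\<close> I by (auto simp: card_gt_0_iff)
  qed
  have le: "cyl_count B f \<C> (k * n) \<le> cyl_count B (f ^^ k) \<U> n * card I ^ n" for n
  proof -
    obtain \<S> where S: "finite \<S>" "\<S> \<subseteq> cylinders B (f ^^ k) \<U> n" "B \<subseteq> \<Union>\<S>"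
        "card \<S> = cyl_count B (f ^^ k) \<U> n"
      using aleph_attained[OF has_finite_subcover_cylinders[OF finU inv']] unfolding cyl_count_def
      by metis
    have "\<forall>V\<in>\<S>. \<exists>c. V = cylinder B (f ^^ k) c n \<and> (\<forall>j<n. c j \<in> \<U>)"
      using S(2) unfolding cylinders_def by blast
    then obtain c where c: "\<And>V. V \<in> \<S> \<Longrightarrow> V = cylinder B (f ^^ k) (c V) n"
        "\<And>V j. \<lbrakk>V \<in> \<S>; j < n\<rbrakk> \<Longrightarrow> c V j \<in> \<U>"
      by metis
    \<comment> \<open>The letter at time \<open>j\<close> is letter \<open>j mod k\<close> of the word chosen by \<open>s\<close> in block \<open>j div k\<close>.\<close>
    let ?W = "\<lambda>(V, s). cylinder B f (\<lambda>j. w (c V (j div k)) (s (j div k)) (j mod k)) (k * n)"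
    let ?P = "\<S> \<times> PiE {..<n} (\<lambda>_. I)"
    have dm: "j div k < n" "j mod k < k" if "j < k * n" for j
      using that k by (auto simp: less_mult_imp_div_less mult.commute)
    have finP: "finite ?P" using S(1) I by (intro finite_cartesian_product finite_PiE) auto
    have sub: "?W ` ?P \<subseteq> cylinders B f \<C> (k * n)"
    proof safe
      fix V s assume "V \<in> \<S>" "s \<in> PiE {..<n} (\<lambda>_. I)"
      then have "\<forall>j<k * n. w (c V (j div k)) (s (j div k)) (j mod k) \<in> \<C>"
        using w c(2) dm by (auto simp: PiE_def Pi_def)
      then show "cylinder B f (\<lambda>j. w (c V (j div k)) (s (j div k)) (j mod k)) (k * n)
          \<in> cylinders B f \<C> (k * n)"
        unfolding cylinders_def by blast
    qed
    have covB: "B \<subseteq> \<Union>(?W ` ?P)"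
    proof
      fix x assume x: "x \<in> B"
      then obtain V where V: "V \<in> \<S>" "x \<in> V" using S(3) by blast
      have "\<exists>s\<in>I. \<forall>i<k. (f ^^ i) ((f ^^ (k * j)) x) \<in> w (c V j) s i" if "j < n" for j
      proof (rule cov)
        show "c V j \<in> \<U>" using c(2) V that by blast
        have "x \<in> cylinder B (f ^^ k) (c V) n" using c(1)[OF V(1)] V(2) by simp
        then show "(f ^^ (k * j)) x \<in> c V j"
          using that by (auto simp: cylinder_def funpow_mult mult.commute)
        show "(f ^^ (k * j)) x \<in> B" by (rule funpow_mem[OF inv x])
      qed
      then obtain s where s: "\<And>j. j < n \<Longrightarrow> s j \<in> I"
          "\<And>i j. \<lbrakk>j < n; i < k\<rbrakk> \<Longrightarrow> (f ^^ i) ((f ^^ (k * j)) x) \<in> w (c V j) (s j) i"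
        by metis
      have "(f ^^ j) x \<in> w (c V (j div k)) (restrict s {..<n} (j div k)) (j mod k)"
        if "j < k * n" for j
      proof -
        have "(f ^^ (j mod k)) ((f ^^ (k * (j div k))) x) = (f ^^ (j mod k + k * (j div k))) x"
          by (simp only: funpow_add o_def)
        also have "j mod k + k * (j div k) = j" by simp
        finally show ?thesis using s(2)[OF dm[OF that]] dm[OF that] by simp
      qed
      then have "x \<in> ?W (V, restrict s {..<n})" using x by (simp add: cylinder_def)
      moreover have "(V, restrict s {..<n}) \<in> ?P" using V(1) s(1) by auto
      ultimately show "x \<in> \<Union>(?W ` ?P)" by blast
    qed
    have "cyl_count B f \<C> (k * n) \<le> card (?W ` ?P)"
      unfolding cyl_count_def by (rule aleph_le_card[OF _ sub covB]) (use finP in auto)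
    also have "\<dots> \<le> card ?P" by (rule card_image_le[OF finP])
    also have "\<dots> = card \<S> * card I ^ n" by (simp add: card_cartesian_product card_PiE)
    finally show ?thesis using S(4) by simp
  qed
  have "\<forall>n\<ge>1. ln (real (cyl_count B f \<C> (k * n))) / real n
      \<le> ln (real (cyl_count B (f ^^ k) \<U> n)) / real n + ln (real (card I))"
  proof (intro allI impI)
    fix n :: nat assume n: "1 \<le> n"
    have "ln (real (cyl_count B f \<C> (k * n))) \<le> ln (real (cyl_count B (f ^^ k) \<U> n * card I ^ n))"
      by (rule ln_of_nat_mono[OF cyl_count_pos[OF finC inv ne] le])
    also have "\<dots> = ln (real (cyl_count B (f ^^ k) \<U> n) * real (card I) ^ n)" by simp
    also have "\<dots> = ln (real (cyl_count B (f ^^ k) \<U> n)) + ln (real (card I) ^ n)"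
      using cyl_count_pos[OF finU inv' ne, of n] I0 by (intro ln_mult_pos) auto
    also have "ln (real (card I) ^ n) = real n * ln (real (card I))"
      using I0 by (simp add: ln_realpow)
    finally have "ln (real (cyl_count B f \<C> (k * n))) / real n
        \<le> (ln (real (cyl_count B (f ^^ k) \<U> n)) + real n * ln (real (card I))) / real n"
      by (rule divide_right_mono) simp
    then show "ln (real (cyl_count B f \<C> (k * n))) / real n
      \<le> ln (real (cyl_count B (f ^^ k) \<U> n)) / real n + ln (real (card I))"
      using n by (simp add: add_divide_distrib)
  qed
  then show ?thesis
    by (intro LIMSEQ_le[OF growth_tendsto_multiples[OF finC inv ne k]
          tendsto_add[OF growth_tendsto[OF finU inv' ne] tendsto_const]]) blast
qed

section \<open>The entropy of a pc-map as a growth rate on regular points\<close>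

lemma X_tilde_iff: "x \<in> X_tilde X D f \<longleftrightarrow> x \<in> X \<and> (\<forall>n. (f ^^ n) x \<in> X - D)"
  by (auto simp: X_tilde_def preimage_def)

lemma X_tilde_subset: "X_tilde X D f \<subseteq> X"
  by (auto simp: X_tilde_iff)

lemma X_tilde_invariant: "f ` X_tilde X D f \<subseteq> X_tilde X D f"
proof
  fix y assume "y \<in> f ` X_tilde X D f"
  then obtain x where x: "y = f x" "\<forall>n. (f ^^ n) x \<in> X - D" by (auto simp: X_tilde_iff)
  have "(f ^^ n) y \<in> X - D" for n
    using x(2)[rule_format, of "Suc n"] by (simp add: x(1) funpow_swap1)
  moreover from this[of 0] have "y \<in> X" by simp
  ultimately show "y \<in> X_tilde X D f" by (simp add: X_tilde_iff)
qed

text \<open>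
  On regular points, whose orbits avoid \<open>D\<close>, removing \<open>D\<close> from the elements of a cover changes
  nothing, and neither does the removal of empty sets from a collection. The entropy of a
  pc-map relative to a cover is therefore the growth rate of \<open>f\<close> on the regular points.
\<close>

lemma htop_on_cover_eq_growth:
  fixes X D A :: "real set" and f :: "real \<Rightarrow> real"
  defines "B \<equiv> A \<inter> X_tilde X D f"
  assumes inv: "f ` B \<subseteq> B" and fin: "has_finite_subcover B \<C>"
  shows "htop_on_cover X D f A \<C> = growth B f \<C>"
proof -
  have orb: "(f ^^ j) x \<in> X" "(f ^^ j) x \<notin> D" "x \<in> X" if "x \<in> B" for x j
    using that by (auto simp: B_def X_tilde_iff)
  have eq: "aleph B (refined_cover X D f \<C> n) = cyl_count B f \<C> n" if n: "n \<ge> 1" for n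
  proof (rule antisym)
    have *: "\<exists>U\<in>refined_cover X D f \<C> n. \<forall>x\<in>B. x \<in> V \<longrightarrow> x \<in> U"
      if V: "V \<in> cylinders B f \<C> n" "\<exists>x\<in>B. x \<in> V" for V
    proof -
      obtain c x0 where c: "V = cylinder B f c n" "\<forall>j<n. c j \<in> \<C>" and x0: "x0 \<in> B" "x0 \<in> V"
        using V unfolding cylinders_def by blast
      let ?E = "\<lambda>j. preimage X f j (c j - D)"
      have x0E: "x0 \<in> ?E j" if "j < n" for j
        using that x0 orb[OF x0(1)] by (auto simp: c(1) cylinder_def preimage_def)
      have "?E j \<in> cover_preimage X f j (cover_remove \<C> D)" if j: "j < n" for j
        using x0E[OF j] c(2) j unfolding cover_preimage_def cover_remove_def
        by (auto simp: preimage_def)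
      moreover have "x0 \<in> (\<Inter>j<n. ?E j)" using x0E by auto
      ultimately have "(\<Inter>j<n. ?E j) \<in> refined_cover X D f \<C> n"
        unfolding refined_cover_def cover_join_def by blast
      moreover have "\<forall>x\<in>B. x \<in> V \<longrightarrow> x \<in> (\<Inter>j<n. ?E j)"
        using orb by (auto simp: c(1) cylinder_def preimage_def)
      ultimately show ?thesis by blast
    qed
    note ** = has_finite_subcover_pullback[OF has_finite_subcover_cylinders[OF fin inv, of n],
        of "\<lambda>x. x" B "refined_cover X D f \<C> n"]
    show "aleph B (refined_cover X D f \<C> n) \<le> cyl_count B f \<C> n"
      unfolding cyl_count_def using **(2) * by simp
    have finR: "has_finite_subcover B (refined_cover X D f \<C> n)" using **(1) * by simp
    show "cyl_count B f \<C> n \<le> aleph B (refined_cover X D f \<C> n)"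
      unfolding cyl_count_def
    proof (rule has_finite_subcover_pullback(2)[OF finR, of "\<lambda>x. x"])
      fix V assume "V \<in> refined_cover X D f \<C> n"
      then obtain E where V: "V = (\<Inter>j<n. E j)"
          and E: "\<forall>j<n. E j \<in> cover_preimage X f j (cover_remove \<C> D)"
        unfolding refined_cover_def cover_join_def by blast
      have "\<exists>c\<in>\<C>. E j = preimage X f j (c - D)" if "j < n" for j
        using E that unfolding cover_preimage_def cover_remove_def by blast
      then obtain c where c: "\<And>j. j < n \<Longrightarrow> c j \<in> \<C>" "\<And>j. j < n \<Longrightarrow> E j = preimage X f j (c j - D)"
        by metis
      have "cylinder B f c n \<in> cylinders B f \<C> n" using c(1) by (auto simp: cylinders_def)
      moreover have "\<forall>x\<in>B. x \<in> V \<longrightarrow> x \<in> cylinder B f c n"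
        using c(2) by (auto simp: V cylinder_def preimage_def)
      ultimately show "\<exists>U\<in>cylinders B f \<C> n. \<forall>x\<in>B. x \<in> V \<longrightarrow> x \<in> U" by blast
    qed auto
  qed
  have "ln (real (aleph B (refined_cover X D f \<C> n))) / real n
      = ln (real (cyl_count B f \<C> n)) / real n" for n
    using eq[of n] by (cases "n = 0") auto
  then show ?thesis unfolding htop_on_cover_def growth_def B_def[symmetric] by presburger
qed

lemma htop_on_eq_SUP_growth:
  assumes "compact A" "f ` (A \<inter> X_tilde X D f) \<subseteq> A \<inter> X_tilde X D f"
  shows "htop_on X D f A = (SUP \<C>\<in>{\<C>. open_cover A \<C>}. ereal (growth (A \<inter> X_tilde X D f) f \<C>))"
  unfolding htop_on_def
  by (intro SUP_cong refl arg_cong[of _ _ ereal] htop_on_cover_eq_growth assms(2)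
        has_finite_subcover_compact[OF assms(1)]) auto

lemma htop_cover_eq_growth:
  assumes "compact X" "open_cover X \<C>"
  shows "htop_cover X D f \<C> = growth (X_tilde X D f) f \<C>"
proof -
  have "X \<inter> X_tilde X D f = X_tilde X D f" using X_tilde_subset[of X D f] by blast
  then show ?thesis
    using htop_on_cover_eq_growth[where A = X and X = X and D = D and f = f]
      has_finite_subcover_compact[OF assms X_tilde_subset] X_tilde_invariant by metis
qed

lemma htop_eq_SUP_growth:
  assumes "compact X"
  shows "htop X D f = (SUP \<C>\<in>{\<C>. open_cover X \<C>}. ereal (growth (X_tilde X D f) f \<C>))"
  unfolding htop_on_def
  by (intro SUP_cong refl arg_cong[of _ _ ereal] htop_cover_eq_growth assms) auto

lemma growth_le_htop:
  assumes "compact X" "open_cover X \<C>"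
  shows "ereal (growth (X_tilde X D f) f \<C>) \<le> htop X D f"
  unfolding htop_eq_SUP_growth[OF assms(1)] using assms(2) by (intro SUP_upper) auto

lemma htop_nonneg:
  assumes "compact X" "X_tilde X D f \<noteq> {}"
  shows "0 \<le> htop X D f"
proof -
  have "X \<noteq> {}" using assms(2) X_tilde_subset by blast
  then have o: "open_cover X {X}" by (auto simp: open_cover_def)
  have "0 \<le> growth (X_tilde X D f) f {X}"
    by (rule growth_nonneg[OF has_finite_subcover_compact[OF assms(1) o X_tilde_subset] X_tilde_invariant assms(2)])
  then show ?thesis using growth_le_htop[OF assms(1) o, of D f] by (metis ereal_less_eq(5) order_trans)
qed

section \<open>Subsets, factors, and finite unions\<close>

text \<open>
  A regular point of a pseudo-invariant set \<open>A\<close> is a point of continuity, so the one-sided limit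
  that lies in \<open>A\<close> is the value of \<open>f\<close>. On regular points pseudo-invariance is thus invariance.
\<close>

lemma admissible_regular_invariant:
  assumes "\<forall>x\<in>X - D. continuous (at x within X) f" and "admissible X D f A"
  shows "f ` (A \<inter> X_tilde X D f) \<subseteq> A \<inter> X_tilde X D f"
proof safe
  fix x assume x: "x \<in> A" "x \<in> X_tilde X D f"
  then show "f x \<in> X_tilde X D f" using X_tilde_invariant by blast
  have "x \<in> X - D" using x(2) unfolding X_tilde_iff by (metis funpow_0)
  then have lim: "(f \<longlongrightarrow> f x) (at x within X)" using assms(1) by (simp add: continuous_within)
  show "f x \<in> A"
  proof (cases "invariant_set f A")
    case True
    then show ?thesis using x by (auto simp: invariant_set_def)
  next
    case False
    then have "pseudo_invariant X f A" using assms(2) by (simp add: admissible_def)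
    then obtain F l where F: "F \<in> {at x within (X \<inter> {x<..}), at x within (X \<inter> {..<x})}" "F \<noteq> bot"
        "l \<in> A" "(f \<longlongrightarrow> l) F"
      using x(1) unfolding pseudo_invariant_def by meson
    then have "F \<le> at x within X" by (auto intro: at_le)
    then have "(f \<longlongrightarrow> f x) F" using lim by (rule tendsto_mono)
    then show ?thesis using tendsto_unique[OF F(2) F(4)] F(3) by simp
  qed
qed

text \<open>
  An open cover of \<open>A\<close> extends to an open cover of \<open>X\<close> that is, on \<open>A\<close>, at least as fine: it consists
  of all open sets of \<open>X\<close> whose trace on \<open>A\<close> is empty or belongs to the given cover.
\<close>

lemma htop_on_le_htop:
  assumes "compact X" "\<forall>x\<in>X - D. continuous (at x within X) f" "admissible X D f A"
  shows "htop_on X D f A \<le> htop X D f"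
proof -
  let ?T = "X_tilde X D f"
  have A: "compact A" "A \<subseteq> X" "A \<inter> ?T \<noteq> {}" using assms(3) by (auto simp: admissible_def)
  note inv = admissible_regular_invariant[OF assms(2,3)]
  show ?thesis
    unfolding htop_on_eq_SUP_growth[OF A(1) inv]
  proof (rule SUP_least)
    fix \<C> assume "\<C> \<in> {\<C>. open_cover A \<C>}"
    then have C: "open_cover A \<C>" by simp
    define \<V> where "\<V> = {V. openin (top_of_set X) V \<and> V \<noteq> {} \<and> (A \<inter> V = {} \<or> A \<inter> V \<in> \<C>)}"
    have "\<exists>V\<in>\<V>. x \<in> V" if x: "x \<in> X" for x
    proof (cases "x \<in> A")
      case True
      then obtain W where W: "W \<in> \<C>" "x \<in> W" using C by (auto simp: open_cover_def)
      then have "openin (top_of_set A) W" using C by (simp add: open_cover_def)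
      then obtain O' where O': "open O'" "W = A \<inter> O'" by (auto simp: openin_open)
      have "A \<inter> (X \<inter> O') = W" using O' A(2) by auto
      then have "X \<inter> O' \<in> \<V>" using W O' x by (auto simp: \<V>_def openin_open_Int)
      then show ?thesis using x W O' by blast
    next
      case False
      have "openin (top_of_set X) (X \<inter> - A)"
        using compact_imp_closed[OF A(1)] by (intro openin_open_Int) auto
      then have "X - A \<in> \<V>" using x False by (auto simp: \<V>_def Diff_eq)
      then show ?thesis using x False by blast
    qed
    moreover from this have "\<V> \<noteq> {}" using A by blast
    ultimately have V: "open_cover X \<V>" by (auto simp: open_cover_def \<V>_def)
    have "growth (A \<inter> ?T) f \<C> \<le> growth ?T f \<V>"
    proof (rule growth_refine_le[OF has_finite_subcover_compact[OF assms(1) V X_tilde_subset]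
            inv X_tilde_invariant _ A(3)])
      fix V assume "V \<in> \<V>" "V \<inter> (A \<inter> ?T) \<noteq> {}"
      then have "A \<inter> V \<in> \<C>" by (auto simp: \<V>_def)
      then show "\<exists>U\<in>\<C>. V \<inter> (A \<inter> ?T) \<subseteq> U" by blast
    qed auto
    then show "ereal (growth (A \<inter> ?T) f \<C>) \<le> htop X D f"
      using growth_le_htop[OF assms(1) V, of D f] by (metis ereal_less_eq(3) order_trans)
  qed
qed

text \<open>
  The regular points of the factor are exactly the images of regular points, because
  \<open>\<phi>\<close> pulls \<open>E\<close> back to \<open>D\<close>. Any section \<open>\<psi>\<close> of \<open>\<phi>\<close> then maps regular points to regular
  points, and the itinerary of \<open>\<psi> y\<close> in the pulled-back cover is an itinerary of \<open>y\<close>.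
\<close>

lemma htop_semi_conjugate_le:
  assumes X: "compact X" "f ` X \<subseteq> X" "X_tilde X D f \<noteq> {}" and Y: "compact Y"
    and semi: "semi_conjugate X D f Y E g"
  shows "htop Y E g \<le> htop X D f"
proof -
  let ?T = "X_tilde X D f" and ?S = "X_tilde Y E g"
  obtain \<phi> where phi: "continuous_on X \<phi>" "\<phi> ` X = Y" "{x \<in> X. \<phi> x \<in> E} = D"
      "\<And>x. x \<in> X - D \<Longrightarrow> \<phi> (f x) = g (\<phi> x)"
    using semi unfolding semi_conjugate_def by metis
  have fX: "(f ^^ n) x \<in> X" if "x \<in> X" for n x using funpow_mem[OF X(2) that] .
  have iter: "\<phi> ((f ^^ n) x) = (g ^^ n) (\<phi> x)"
    if "x \<in> X" "\<And>j. j < n \<Longrightarrow> (f ^^ j) x \<notin> D" for n x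
    using that
  proof (induction n)
    case (Suc n)
    have "\<phi> ((f ^^ n) x) = (g ^^ n) (\<phi> x)" using Suc by simp
    moreover have "(f ^^ n) x \<in> X - D" using Suc.prems fX by auto
    ultimately show ?case using phi(4) by simp
  qed simp
  have TS: "\<phi> x \<in> ?S" if x: "x \<in> ?T" for x
  proof -
    have x': "x \<in> X" "\<And>n. (f ^^ n) x \<in> X - D" using x by (auto simp: X_tilde_iff)
    have "(g ^^ n) (\<phi> x) \<in> Y - E" for n
      using iter[OF x'(1), of n] x'(2) phi(2,3) by (metis (no_types, lifting) DiffD1 DiffD2 DiffI imageI mem_Collect_eq)
    then show ?thesis using x'(1) phi(2) by (auto simp: X_tilde_iff)
  qed
  have ST: "x \<in> ?T" if x: "x \<in> X" "\<phi> x \<in> ?S" for x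
  proof -
    have "(f ^^ n) x \<notin> D" for n
    proof (induction n rule: less_induct)
      case (less n)
      then have "\<phi> ((f ^^ n) x) = (g ^^ n) (\<phi> x)" using iter[OF x(1)] by blast
      moreover have "(g ^^ n) (\<phi> x) \<notin> E" using x(2) by (auto simp: X_tilde_iff)
      ultimately show ?case using phi(3) by auto
    qed
    then show ?thesis using x(1) fX by (auto simp: X_tilde_iff)
  qed
  show ?thesis
    unfolding htop_eq_SUP_growth[OF Y]
  proof (rule SUP_least)
    fix \<C> assume "\<C> \<in> {\<C>. open_cover Y \<C>}"
    then have C: "open_cover Y \<C>" by simp
    define \<V> where "\<V> = (\<lambda>C. X \<inter> \<phi> -` C) ` \<C>"
    have V: "open_cover X \<V>"
      unfolding open_cover_def
    proof (intro conjI ballI)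
      show "\<V> \<noteq> {}" using C by (auto simp: \<V>_def open_cover_def)
      show "X \<subseteq> \<Union>\<V>" using C phi(2) by (auto simp: \<V>_def open_cover_def)
      fix V assume "V \<in> \<V>"
      then obtain W where W: "V = X \<inter> \<phi> -` W" "W \<in> \<C>" by (auto simp: \<V>_def)
      then have W': "openin (top_of_set Y) W" "W \<noteq> {}" using C by (auto simp: open_cover_def)
      then show "V \<noteq> {}" using W phi(2) openin_imp_subset by fastforce
      show "openin (top_of_set X) V"
        using continuous_openin_preimage[OF phi(1) _ W'(1)] phi(2) W(1) by auto
    qed
    have neS: "?S \<noteq> {}" using X(3) TS by blast
    have "\<forall>y\<in>?S. \<exists>x. x \<in> X \<and> \<phi> x = y" using phi(2) X_tilde_subset[of Y E g] by blast
    then obtain \<psi> where psi: "\<And>y. y \<in> ?S \<Longrightarrow> \<psi> y \<in> X" "\<And>y. y \<in> ?S \<Longrightarrow> \<phi> (\<psi> y) = y" by metis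
    have "growth ?S g \<C> \<le> growth ?T f \<V>"
    proof (rule growth_pullback_le[OF has_finite_subcover_compact[OF X(1) V X_tilde_subset]
            X_tilde_invariant X_tilde_invariant _ neS])
      show "\<psi> ` ?S \<subseteq> ?T" using ST psi by auto
      fix V assume "V \<in> \<V>"
      then obtain W where W: "V = X \<inter> \<phi> -` W" "W \<in> \<C>" by (auto simp: \<V>_def)
      have "(g ^^ j) y \<in> W" if y: "y \<in> ?S" "(f ^^ j) (\<psi> y) \<in> V" for y j
      proof -
        have "\<psi> y \<in> ?T" using ST psi y(1) by auto
        then have "\<phi> ((f ^^ j) (\<psi> y)) = (g ^^ j) y"
          using iter[of "\<psi> y" j] psi(2)[OF y(1)] by (auto simp: X_tilde_iff)
        then show ?thesis using y(2) W(1) by auto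
      qed
      then show "\<exists>U\<in>\<C>. \<forall>y\<in>?S. \<forall>j. (f ^^ j) (\<psi> y) \<in> V \<longrightarrow> (g ^^ j) y \<in> U"
        using W(2) by blast
    qed
    then show "ereal (growth ?S g \<C>) \<le> htop X D f"
      using growth_le_htop[OF X(1) V, of D f] by (metis ereal_less_eq(3) order_trans)
  qed
qed

lemma htop_eq_Max_htop_on:
  assumes X: "compact X" "\<forall>x\<in>X - D. continuous (at x within X) f"
    and I: "finite I" "I \<noteq> {}" and un: "X = (\<Union>i\<in>I. A i)"
    and adm: "\<And>i. i \<in> I \<Longrightarrow> admissible X D f (A i)"
  shows "htop X D f = Max ((\<lambda>i. htop_on X D f (A i)) ` I)"
proof (rule antisym)
  let ?T = "X_tilde X D f" and ?M = "Max ((\<lambda>i. htop_on X D f (A i)) ` I)"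
  show "?M \<le> htop X D f"
    using I htop_on_le_htop[OF X adm] by (intro Max.boundedI) auto
  have Ai: "compact (A i)" "A i \<subseteq> X" "A i \<inter> ?T \<noteq> {}" if "i \<in> I" for i
    using adm[OF that] by (auto simp: admissible_def)
  note inv = admissible_regular_invariant[OF X(2) adm]
  show "htop X D f \<le> ?M"
    unfolding htop_eq_SUP_growth[OF X(1)]
  proof (rule SUP_least)
    fix \<C> assume "\<C> \<in> {\<C>. open_cover X \<C>}"
    then have C: "open_cover X \<C>" by simp
    define G where "G i = growth (A i \<inter> ?T) f \<C>" for i
    have "Max (G ` I) \<in> G ` I" using I by (intro Max_in) auto
    then obtain m where m: "m \<in> I" "Max (G ` I) = G m" by auto
    let ?D = "(\<lambda>C. A m \<inter> C) ` \<C> - {{}}"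
    have D: "open_cover (A m) ?D"
      unfolding open_cover_def
    proof (intro conjI ballI)
      have "A m \<subseteq> \<Union>\<C>" using C Ai(2)[OF m(1)] by (auto simp: open_cover_def)
      then show "A m \<subseteq> \<Union>?D" by blast
      then show "?D \<noteq> {}" using Ai(3)[OF m(1)] by blast
      fix V assume "V \<in> ?D"
      then obtain W where W: "W \<in> \<C>" "V = A m \<inter> W" "V \<noteq> {}" by blast
      then have "openin (top_of_set X) W" using C by (simp add: open_cover_def)
      then obtain O' where "open O'" "W = X \<inter> O'" by (auto simp: openin_open)
      then have "open O'" "V = A m \<inter> O'" using W(2) Ai(2)[OF m(1)] by auto
      then show "openin (top_of_set (A m)) V" by (auto simp: openin_open)
    qed auto
    have "growth ?T f \<C> \<le> G m"
    proof (rule growth_UN_le[OF I has_finite_subcover_compact[OF X(1) C X_tilde_subset] _ inv])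
      show "?T = (\<Union>i\<in>I. A i \<inter> ?T)" using un X_tilde_subset[of X D f] by blast
      show "growth (A i \<inter> ?T) f \<C> \<le> G m" if "i \<in> I" for i
        using that I(1) unfolding m(2)[symmetric] G_def[symmetric] by (intro Max_ge) auto
    qed (use Ai in auto)
    also have "G m \<le> growth (A m \<inter> ?T) f ?D"
      unfolding G_def
      by (rule growth_refine_le[OF has_finite_subcover_compact[OF Ai(1)[OF m(1)] D] inv[OF m(1)]
            inv[OF m(1)] order_refl Ai(3)[OF m(1)]]) auto
    finally have "ereal (growth ?T f \<C>) \<le> ereal (growth (A m \<inter> ?T) f ?D)" by simp
    also have "\<dots> \<le> htop_on X D f (A m)"
      unfolding htop_on_eq_SUP_growth[OF Ai(1)[OF m(1)] inv[OF m(1)]]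
      using D by (intro SUP_upper) auto
    also have "\<dots> \<le> ?M" using I(1) m(1) by (intro Max_ge) auto
    finally show "ereal (growth ?T f \<C>) \<le> ?M" .
  qed
qed


section \<open>Fine covers\<close>

lemma open_cover_lebesgue_number:
  fixes A :: "'a::metric_space set"
  assumes "compact A" "open_cover A \<C>"
  obtains e where "0 < e" "\<And>x. x \<in> A \<Longrightarrow> \<exists>C\<in>\<C>. A \<inter> ball x e \<subseteq> C"
proof -
  have cov: "A \<subseteq> \<Union>{O'. open O' \<and> A \<inter> O' \<in> \<C>}"
  proof
    fix x assume "x \<in> A"
    then obtain C where C: "C \<in> \<C>" "x \<in> C" using assms(2) by (auto simp: open_cover_def)
    then have "openin (top_of_set A) C" using assms(2) by (simp add: open_cover_def)
    then obtain O' where "open O'" "C = A \<inter> O'" by (auto simp: openin_open)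
    then show "x \<in> \<Union>{O'. open O' \<and> A \<inter> O' \<in> \<C>}" using C by auto
  qed
  have "\<And>G. G \<in> {O'. open O' \<and> A \<inter> O' \<in> \<C>} \<Longrightarrow> open G" by simp
  from Heine_Borel_lemma[OF assms(1) cov this]
  obtain e where e: "0 < e" "\<And>x. x \<in> A \<Longrightarrow> \<exists>G\<in>{O'. open O' \<and> A \<inter> O' \<in> \<C>}. ball x e \<subseteq> G"
    by blast
  have "\<exists>C\<in>\<C>. A \<inter> ball x e \<subseteq> C" if x: "x \<in> A" for x
  proof -
    obtain G where "A \<inter> G \<in> \<C>" "ball x e \<subseteq> G" using e(2)[OF x] by auto
    then show ?thesis by (intro bexI[of _ "A \<inter> G"]) auto
  qed
  then show thesis using that e(1) by blast
qed

text \<open>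
  Once the diameter is below a Lebesgue number of \<open>\<C>\<close>, the covers refine \<open>\<C>\<close>.
\<close>

lemma htop_cover_eventually_ge:
  fixes X D :: "real set" and f :: "real \<Rightarrow> real" and \<D> :: "nat \<Rightarrow> real set set"
  assumes X: "compact X" "X_tilde X D f \<noteq> {}" and C: "open_cover X \<C>"
    and D: "\<forall>k\<ge>1. open_cover X (\<D> k)" and lim: "(\<lambda>k. cover_diam (\<D> k)) \<longlonglongrightarrow> 0"
  shows "\<forall>\<^sub>F k in sequentially. htop_cover X D f \<C> \<le> htop_cover X D f (\<D> k)"
proof -
  obtain e where e: "0 < e" "\<And>x. x \<in> X \<Longrightarrow> \<exists>C\<in>\<C>. X \<inter> ball x e \<subseteq> C"
    using open_cover_lebesgue_number[OF X(1) C] by metis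
  have "\<forall>\<^sub>F k in sequentially. cover_diam (\<D> k) < e"
    using lim e(1) by (rule order_tendstoD)
  then show ?thesis using eventually_ge_at_top[of 1]
  proof eventually_elim
    case (elim k)
    note Dk = D[rule_format, OF elim(2)]
    have "growth (X_tilde X D f) f \<C> \<le> growth (X_tilde X D f) f (\<D> k)"
    proof (rule growth_refine_le[OF has_finite_subcover_compact[OF X(1) Dk X_tilde_subset]
            X_tilde_invariant X_tilde_invariant order_refl X(2)])
      fix V assume V: "V \<in> \<D> k" "V \<inter> X_tilde X D f \<noteq> {}"
      have VX: "W \<subseteq> X" if "W \<in> \<D> k" for W
        using Dk that by (auto simp: open_cover_def dest: openin_imp_subset)
      obtain x where x: "x \<in> V" using V by blast
      have bdd: "bdd_above (diameter ` \<D> k)"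
        using VX compact_imp_bounded[OF X(1)] by (intro bdd_aboveI2[of _ _ "diameter X"] diameter_subset)
      have "V \<subseteq> ball x e"
      proof
        fix y assume "y \<in> V"
        then have "dist x y \<le> diameter V"
          using x VX[OF V(1)] compact_imp_bounded[OF X(1)] by (intro diameter_bounded_bound) (auto intro: bounded_subset)
        also have "\<dots> \<le> cover_diam (\<D> k)"
          unfolding cover_diam_def by (rule cSUP_upper[OF V(1) bdd])
        finally show "y \<in> ball x e" using elim(1) by simp
      qed
      moreover obtain C' where "C' \<in> \<C>" "X \<inter> ball x e \<subseteq> C'" using e(2)[of x] x VX[OF V(1)] by blast
      ultimately show "\<exists>U\<in>\<C>. V \<inter> X_tilde X D f \<subseteq> U" using VX[OF V(1)] by blast
    qed
    then show ?case
      using htop_cover_eq_growth[OF X(1) C, of D f] htop_cover_eq_growth[OF X(1) Dk, of D f] by simp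
  qed
qed

text \<open>
  The entropy is the supremum over all covers, and each single cover is eventually beaten. This
  covers finite and infinite entropy alike, because the limit is taken in the extended reals.
\<close>

lemma htop_cover_tendsto:
  fixes X D :: "real set" and f :: "real \<Rightarrow> real" and \<D> :: "nat \<Rightarrow> real set set"
  assumes X: "compact X" "X_tilde X D f \<noteq> {}"
    and D: "\<forall>k\<ge>1. open_cover X (\<D> k)" and lim: "(\<lambda>k. cover_diam (\<D> k)) \<longlonglongrightarrow> 0"
  shows "(\<lambda>k. ereal (htop_cover X D f (\<D> k))) \<longlonglongrightarrow> htop X D f"
proof (rule order_tendstoI)
  fix a assume "a < htop X D f"
  then obtain \<C> where C: "open_cover X \<C>" "a < ereal (htop_cover X D f \<C>)"
    unfolding htop_on_def less_SUP_iff by auto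
  show "\<forall>\<^sub>F k in sequentially. a < ereal (htop_cover X D f (\<D> k))"
    using htop_cover_eventually_ge[OF X C(1) D lim]
    by eventually_elim (use C(2) in \<open>auto intro: less_le_trans\<close>)
next
  fix a assume a: "htop X D f < a"
  have le: "ereal (htop_cover X D f (\<D> k)) \<le> htop X D f" if "k \<ge> 1" for k
    unfolding htop_on_def using D that by (intro SUP_upper) auto
  show "\<forall>\<^sub>F k in sequentially. ereal (htop_cover X D f (\<D> k)) < a"
    using eventually_ge_at_top[of 1] by eventually_elim (use a le in \<open>auto intro: le_less_trans\<close>)
qed

section \<open>Continuous maps\<close>

text \<open>
  Without discontinuities every point is regular, and the two definitions agree literally.
  What remains to compare is the growth rate on all of \<open>X\<close> with that on the regular points.
\<close>

lemma akm_entropy_eq_htop_empty: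
  assumes "f ` X \<subseteq> X"
  shows "akm_entropy X f = htop X {} f"
proof -
  have T: "X \<inter> X_tilde X {} f = X" using funpow_mem[OF assms] by (auto simp: X_tilde_iff)
  have "cover_remove \<C> {} = \<C>" if "open_cover X \<C>" for \<C>
    using that by (auto simp: cover_remove_def open_cover_def)
  then show ?thesis
    unfolding akm_entropy_def htop_on_def
    by (intro SUP_cong) (auto simp: akm_entropy_cover_def htop_on_cover_def refined_cover_def T)
qed

lemma continuous_on_funpow:
  assumes "continuous_on X f" "f ` X \<subseteq> X"
  shows "continuous_on X (f ^^ n)"
proof (induction n)
  case (Suc n)
  then show ?case
    using continuous_on_compose2[OF assms(1) Suc] funpow_mem[OF assms(2)] by (simp add: o_def image_subset_iff)
qed (simp add: id_def continuous_on_id)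

text \<open>
  Cylinders that cover the dense set \<open>T\<close> have closures that cover \<open>X\<close>. By continuity of the iterates the
  closure of a cylinder lies in the cylinder over the closures of its letters, hence in a
  cylinder for the coarser cover \<open>\<U>\<close>.
\<close>

lemma growth_dense_le:
  fixes X :: "'a::topological_space set"
  assumes X: "closed X" "continuous_on X f" "f ` X \<subseteq> X" "X \<noteq> {}"
    and T: "T \<subseteq> X" "X \<subseteq> closure T" "f ` T \<subseteq> T"
    and U: "has_finite_subcover X \<U>" and V: "has_finite_subcover T \<V>"
    and cl: "\<And>V. V \<in> \<V> \<Longrightarrow> \<exists>U\<in>\<U>. X \<inter> closure V \<subseteq> U"
  shows "growth X f \<U> \<le> growth T f \<V>"
proof -
  have neT: "T \<noteq> {}" using T(2) X(4) by auto
  show ?thesis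
  proof (rule growth_le_of_cyl_count_le[OF U X(3,4) V T(3) neT])
    fix n
    obtain \<S> where S: "finite \<S>" "\<S> \<subseteq> cylinders T f \<V> n" "T \<subseteq> \<Union>\<S>" "card \<S> = cyl_count T f \<V> n"
      using aleph_attained[OF has_finite_subcover_cylinders[OF V T(3)]] unfolding cyl_count_def
      by metis
    have "\<exists>R\<in>cylinders X f \<U> n. closure V' \<subseteq> R" if V': "V' \<in> \<S>" for V'
    proof -
      obtain c where c: "V' = cylinder T f c n" "\<forall>j<n. c j \<in> \<V>"
        using V' S(2) unfolding cylinders_def by blast
      have "\<exists>U. U \<in> \<U> \<and> X \<inter> closure (c j) \<subseteq> U" if "j < n" for j
        using cl[of "c j"] c(2) that by blast
      then obtain d where d: "\<And>j. j < n \<Longrightarrow> d j \<in> \<U>" "\<And>j. j < n \<Longrightarrow> X \<inter> closure (c j) \<subseteq> d j"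
        by metis
      have V'X: "closure V' \<subseteq> X"
        using T(1) by (intro closure_minimal[OF _ X(1)]) (auto simp: c(1) cylinder_def)
      have "(f ^^ j) x \<in> d j" if j: "j < n" and x: "x \<in> closure V'" for j x
      proof -
        have "(f ^^ j) ` closure V' \<subseteq> closure (c j)"
        proof (rule image_closure_subset)
          show "continuous_on (closure V') (f ^^ j)"
            by (rule continuous_on_subset[OF continuous_on_funpow[OF X(2,3)] V'X])
          show "(f ^^ j) ` V' \<subseteq> closure (c j)"
            using j closure_subset[of "c j"] by (auto simp: c(1) cylinder_def)
        qed simp
        moreover have "(f ^^ j) x \<in> X" using funpow_mem[OF X(3)] V'X x by blast
        ultimately show ?thesis using d(2)[OF j] x by blast
      qed
      then have "closure V' \<subseteq> cylinder X f d n" using V'X by (auto simp: cylinder_def)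
      moreover have "cylinder X f d n \<in> cylinders X f \<U> n" using d(1) by (auto simp: cylinders_def)
      ultimately show ?thesis by blast
    qed
    then obtain r where r: "\<And>V. V \<in> \<S> \<Longrightarrow> r V \<in> cylinders X f \<U> n" "\<And>V. V \<in> \<S> \<Longrightarrow> closure V \<subseteq> r V"
      by metis
    have "closed (\<Union>V\<in>\<S>. closure V)" using S(1) by (intro closed_UN) auto
    moreover have "T \<subseteq> (\<Union>V\<in>\<S>. closure V)" 
    proof
      fix x assume "x \<in> T"
      then obtain V where "V \<in> \<S>" "x \<in> V" using S(3) by blast
      then show "x \<in> (\<Union>V\<in>\<S>. closure V)" using closure_subset[of V] by blast
    qed
    ultimately have "closure T \<subseteq> (\<Union>V\<in>\<S>. closure V)" by (rule closure_minimal[rotated])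
    then have "X \<subseteq> (\<Union>V\<in>\<S>. closure V)" using T(2) by blast
    also have "\<dots> \<subseteq> \<Union>(r ` \<S>)" using r(2) by blast
    finally have "cyl_count X f \<U> n \<le> card (r ` \<S>)"
      unfolding cyl_count_def using S(1) r(1) by (intro aleph_le_card) auto
    also have "\<dots> \<le> card \<S>" by (rule card_image_le[OF S(1)])
    finally show "cyl_count X f \<U> n \<le> cyl_count T f \<V> n" using S(4) by simp
  qed
qed

lemma htop_continuous_eq_akm:
  assumes X: "compact X" "f ` X \<subseteq> X" "X \<noteq> {}" "continuous_on X f"
    and dense: "X \<subseteq> closure (X_tilde X D f)"
  shows "htop X D f = akm_entropy X f"
proof -
  let ?T = "X_tilde X D f"
  have T0: "X_tilde X {} f = X" using funpow_mem[OF X(2)] by (auto simp: X_tilde_iff)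
  have neT: "?T \<noteq> {}" using dense X(3) by auto
  have "htop X D f = htop X {} f"
  proof (rule antisym)
    show "htop X D f \<le> htop X {} f"
      unfolding htop_eq_SUP_growth[OF X(1)] T0
    proof (rule SUP_mono)
      fix \<C> assume "\<C> \<in> {\<C>. open_cover X \<C>}"
      then have C: "open_cover X \<C>" by simp
      have "growth ?T f \<C> \<le> growth X f \<C>"
        by (rule growth_refine_le[OF has_finite_subcover_compact[OF X(1) C order_refl]
              X_tilde_invariant X(2) X_tilde_subset neT]) blast
      then show "\<exists>\<C>'\<in>{\<C>. open_cover X \<C>}. ereal (growth ?T f \<C>) \<le> ereal (growth X f \<C>')"
        using C by auto
    qed
    show "htop X {} f \<le> htop X D f"
      unfolding htop_eq_SUP_growth[OF X(1)] T0
    proof (rule SUP_mono)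
      fix \<C> assume "\<C> \<in> {\<C>. open_cover X \<C>}"
      then have C: "open_cover X \<C>" by simp
      obtain e where e: "0 < e" "\<And>x. x \<in> X \<Longrightarrow> \<exists>C\<in>\<C>. X \<inter> ball x e \<subseteq> C"
        using open_cover_lebesgue_number[OF X(1) C] by metis
      define \<V> where "\<V> = (\<lambda>x. X \<inter> ball x (e/2)) ` X"
      have V: "open_cover X \<V>"
        using e(1) X(3) by (auto simp: open_cover_def \<V>_def openin_open_Int)
      have "growth X f \<C> \<le> growth ?T f \<V>"
      proof (rule growth_dense_le[OF compact_imp_closed[OF X(1)] X(4,2,3) X_tilde_subset dense
            X_tilde_invariant has_finite_subcover_compact[OF X(1) C order_refl]
            has_finite_subcover_compact[OF X(1) V X_tilde_subset]])
        fix V assume "V \<in> \<V>"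
        then obtain x where x: "x \<in> X" "V = X \<inter> ball x (e/2)" by (auto simp: \<V>_def)
        have "closure V \<subseteq> cball x (e/2)" using x(2) by (intro closure_minimal) auto
        then have "X \<inter> closure V \<subseteq> X \<inter> ball x e" using e(1) by force
        then show "\<exists>U\<in>\<C>. X \<inter> closure V \<subseteq> U" using e(2)[OF x(1)] by blast
      qed
      then show "\<exists>\<C>'\<in>{\<C>. open_cover X \<C>}. ereal (growth X f \<C>) \<le> ereal (growth ?T f \<C>')"
        using V by auto
    qed
  qed
  then show ?thesis using akm_entropy_eq_htop_empty[OF X(2)] by simp
qed

section \<open>One-sided limits and iterates\<close>

text \<open>
  One of the two filters is trivial when \<open>x\<close> is an endpoint of \<open>X\<close>; every limit then exists along it.
\<close>

definition one_sided :: "real set \<Rightarrow> real \<Rightarrow> real filter set" where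
  "one_sided X x = {at x within (X \<inter> {x<..}), at x within (X \<inter> {..<x})}"

text \<open>
  More is required than the existence of one-sided limits: the limit is approached strictly from
  one side. This makes the property stable under composition: the next application of \<open>f\<close> sees a
  one-sided approach again, even when the limit is a discontinuity.
\<close>

definition has_one_sided_limits :: "real set \<Rightarrow> (real \<Rightarrow> real) \<Rightarrow> bool" where
  "has_one_sided_limits X f \<longleftrightarrow>
     (\<forall>x\<in>X. \<forall>F\<in>one_sided X x. \<exists>l\<in>X. \<exists>G\<in>one_sided X l. filterlim f G F)"

lemma has_one_sided_limits_funpow:
  assumes "has_one_sided_limits X f"
  shows "has_one_sided_limits X (f ^^ n)"
proof (induction n)
  case 0
  show ?case
    unfolding has_one_sided_limits_def
  proof (intro ballI)
    fix x F assume "x \<in> X" "F \<in> one_sided X x"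
    moreover have "filterlim (f ^^ 0) F F" by (simp add: id_def filterlim_ident)
    ultimately show "\<exists>l\<in>X. \<exists>G\<in>one_sided X l. filterlim (f ^^ 0) G F" by blast
  qed
next
  case (Suc n)
  show ?case
    unfolding has_one_sided_limits_def
  proof (intro ballI)
    fix x F assume "x \<in> X" "F \<in> one_sided X x"
    then obtain l G where G: "l \<in> X" "G \<in> one_sided X l" "filterlim (f ^^ n) G F"
      using Suc unfolding has_one_sided_limits_def by blast
    then obtain l' G' where G': "l' \<in> X" "G' \<in> one_sided X l'" "filterlim f G' G"
      using assms unfolding has_one_sided_limits_def by blast
    have "filterlim (f ^^ Suc n) G' F"
      using filterlim_compose[OF G'(3) G(3)] by (simp add: o_def)
    then show "\<exists>l\<in>X. \<exists>G\<in>one_sided X l. filterlim (f ^^ Suc n) G F" using G' by blast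
  qed
qed

lemma one_sided_le_at: "F \<in> one_sided X x \<Longrightarrow> F \<le> at x within X"
  by (auto simp: one_sided_def intro: at_le)

lemma at_within_eq_sup_one_sided:
  "at x within X = sup (at x within (X \<inter> {x<..})) (at x within (X \<inter> {..<x}))" for x :: real
proof -
  have "at x within X = at x within (X \<inter> {x<..} \<union> X \<inter> {..<x})"
    by (auto simp: filter_eq_iff eventually_at_filter elim!: eventually_mono)
  then show ?thesis by (simp add: at_within_union)
qed

text \<open>
  An infinite fibre accumulates at some point, but \<open>f\<close> approaches its one-sided limits there without
  attaining them, so it omits any given value in a punctured neighbourhood of the point.
\<close>

lemma finite_fibre:
  assumes "compact X" "has_one_sided_limits X f"
  shows "finite {x \<in> X. f x = y}"
proof (rule ccontr)
  assume "infinite {x \<in> X. f x = y}"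
  then obtain x where x: "x \<in> X" "x islimpt {x \<in> X. f x = y}"
    using Heine_Borel_imp_Bolzano_Weierstrass[OF assms(1), of "{x \<in> X. f x = y}"] by auto
  have "\<forall>\<^sub>F z in F. f z \<noteq> y" if F: "F \<in> one_sided X x" for F
  proof -
    obtain l G where G: "l \<in> X" "G \<in> one_sided X l" "filterlim f G F"
      using assms(2) x(1) F unfolding has_one_sided_limits_def by blast
    have "\<forall>\<^sub>F z in at l within X. z \<noteq> y"
    proof (cases "l = y")
      case True
      then show ?thesis by (simp add: eventually_at_filter)
    next
      case False
      then have "\<forall>\<^sub>F z in nhds l. z \<noteq> y" by (rule t1_space_nhds)
      then show ?thesis by (simp add: eventually_at_filter eventually_mono)
    qed
    then have "\<forall>\<^sub>F z in G. z \<noteq> y" by (rule filter_leD[OF one_sided_le_at[OF G(2)]])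
    then show ?thesis by (rule eventually_compose_filterlim[OF _ G(3)])
  qed
  then have "\<forall>\<^sub>F z in at x within X. f z \<noteq> y"
    unfolding at_within_eq_sup_one_sided[of x X] eventually_sup by (auto simp: one_sided_def)
  then have "\<forall>\<^sub>F z in at x. z \<notin> {x \<in> X. f x = y}"
    unfolding eventually_at_filter by (rule eventually_mono) auto
  then show False using x(2) unfolding islimpt_iff_eventually by blast
qed

text \<open>
  By finiteness of the fibres of the iterates the points whose orbit hits \<open>D\<close> form a countable set, which
  contains no non-empty open subset of \<open>X\<close>.
\<close>

lemma regular_points_dense:
  assumes X: "compact X" "f ` X \<subseteq> X" "has_one_sided_limits X f"
    and D: "finite D" and big: "\<And>O'. open O' \<Longrightarrow> X \<inter> O' \<noteq> {} \<Longrightarrow> uncountable (X \<inter> O')"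
  shows "X \<subseteq> closure (X_tilde X D f)"
proof
  fix x assume x: "x \<in> X"
  have co: "X - X_tilde X D f \<subseteq> (\<Union>n. \<Union>y\<in>D. {x \<in> X. (f ^^ n) x = y})"
  proof
    fix z assume z: "z \<in> X - X_tilde X D f"
    then obtain n where "(f ^^ n) z \<notin> X - D" by (auto simp: X_tilde_iff)
    then have "(f ^^ n) z \<in> D" using funpow_mem[OF X(2), of z n] z by blast
    then show "z \<in> (\<Union>n. \<Union>y\<in>D. {x \<in> X. (f ^^ n) x = y})" using z by blast
  qed
  have "countable {x \<in> X. (f ^^ n) x = y}" for n y
    by (rule countable_finite[OF finite_fibre[OF X(1) has_one_sided_limits_funpow[OF X(3)]]])
  then have "countable (\<Union>n. \<Union>y\<in>D. {x \<in> X. (f ^^ n) x = y})"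
    using countable_finite[OF D] by (intro countable_UN) auto
  then have cnt: "countable (X - X_tilde X D f)" by (rule countable_subset[OF co])
  show "x \<in> closure (X_tilde X D f)"
  proof (rule ccontr)
    assume "x \<notin> closure (X_tilde X D f)"
    then have "uncountable (X \<inter> - closure (X_tilde X D f))" using x by (intro big) auto
    moreover have "X \<inter> - closure (X_tilde X D f) \<subseteq> X - X_tilde X D f"
      using closure_subset[of "X_tilde X D f"] by blast
    ultimately show False using countable_subset[OF _ cnt] by blast
  qed
qed

text \<open>
  Since all iterates have one-sided limits, the points close enough to \<open>x\<close> on one side share their
  first \<open>k\<close> letters.
\<close>

lemma one_sided_itinerary:
  assumes f: "has_one_sided_limits X f" and C: "open_cover X \<C>" and x: "x \<in> X" and F: "F \<in> one_sided X x"
  shows "\<exists>v. (\<forall>i<k. v i \<in> \<C>) \<and> (\<forall>\<^sub>F y in F. y \<in> X \<longrightarrow> (\<forall>i<k. (f ^^ i) y \<in> v i))"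
proof -
  have "\<exists>U\<in>\<C>. \<forall>\<^sub>F y in F. (f ^^ i) y \<in> U" for i
  proof -
    obtain l G where G: "l \<in> X" "G \<in> one_sided X l" "filterlim (f ^^ i) G F"
      using has_one_sided_limits_funpow[OF f, of i] x F unfolding has_one_sided_limits_def by blast
    obtain U where U: "U \<in> \<C>" "l \<in> U" using C G(1) by (auto simp: open_cover_def)
    then have "openin (top_of_set X) U" using C by (simp add: open_cover_def)
    then obtain O' where O': "open O'" "U = X \<inter> O'" by (auto simp: openin_open)
    have "\<forall>\<^sub>F z in at l within X. z \<in> U"
      unfolding eventually_at_topological using O' U(2) by (intro exI[of _ O']) auto
    then have "\<forall>\<^sub>F z in G. z \<in> U" by (rule filter_leD[OF one_sided_le_at[OF G(2)]])
    then have "\<forall>\<^sub>F y in F. (f ^^ i) y \<in> U" by (rule eventually_compose_filterlim[OF _ G(3)])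
    then show ?thesis using U(1) by blast
  qed
  then obtain v where v: "\<And>i. v i \<in> \<C>" "\<And>i. \<forall>\<^sub>F y in F. (f ^^ i) y \<in> v i" by metis
  have "\<forall>\<^sub>F y in F. \<forall>i\<in>{..<k}. (f ^^ i) y \<in> v i"
    using v(2) by (intro eventually_ball_finite) auto
  then have "\<forall>\<^sub>F y in F. y \<in> X \<longrightarrow> (\<forall>i<k. (f ^^ i) y \<in> v i)" by (rule eventually_mono) auto
  then show ?thesis using v(1) by blast
qed

text \<open>
  The join of the preimages of \<open>\<C>\<close> need not be an open cover of \<open>X\<close> when \<open>f\<close> is discontinuous. A
  sufficiently small neighbourhood of a point \<open>x\<close> nevertheless needs only three words: one for each
  side of \<open>x\<close> and one for \<open>x\<close> itself. The sign of \<open>y - x\<close> selects the word.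
\<close>

lemma itinerary_cover:
  assumes X: "f ` X \<subseteq> X" "X \<noteq> {}" "has_one_sided_limits X f" and C: "open_cover X \<C>"
  obtains \<U> and w :: "real set \<Rightarrow> real \<Rightarrow> nat \<Rightarrow> real set" where "open_cover X \<U>"
    "\<And>U s i. \<lbrakk>U \<in> \<U>; s \<in> {-1, 0, 1}; i < k\<rbrakk> \<Longrightarrow> w U s i \<in> \<C>"
    "\<And>U y. \<lbrakk>U \<in> \<U>; y \<in> U\<rbrakk> \<Longrightarrow> \<exists>s\<in>{-1, 0, 1}. \<forall>i<k. (f ^^ i) y \<in> w U s i"
proof -
  define I :: "real set" where "I = {-1, 0, 1}"
  have sgnI: "sgn z \<in> I" for z :: real by (simp add: I_def sgn_if)
  have "\<forall>x\<in>X. \<exists>U w. openin (top_of_set X) U \<and> x \<in> U \<and> (\<forall>s\<in>I. \<forall>i<k. w s i \<in> \<C>) \<and>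
      (\<forall>y\<in>U. \<forall>i<k. (f ^^ i) y \<in> w (sgn (y - x)) i)"
  proof
    fix x assume x: "x \<in> X"
    have "at x within (X \<inter> {x<..}) \<in> one_sided X x" by (simp add: one_sided_def)
    from one_sided_itinerary[where k = k, OF X(3) C x this] obtain r where r: "\<forall>i<k. r i \<in> \<C>"
        "\<forall>\<^sub>F y in at x within (X \<inter> {x<..}). y \<in> X \<longrightarrow> (\<forall>i<k. (f ^^ i) y \<in> r i)"
      by blast
    have "at x within (X \<inter> {..<x}) \<in> one_sided X x" by (simp add: one_sided_def)
    from one_sided_itinerary[where k = k, OF X(3) C x this] obtain l where l: "\<forall>i<k. l i \<in> \<C>"
        "\<forall>\<^sub>F y in at x within (X \<inter> {..<x}). y \<in> X \<longrightarrow> (\<forall>i<k. (f ^^ i) y \<in> l i)"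
      by blast
    have "\<exists>U\<in>\<C>. (f ^^ i) x \<in> U" for i
      using C funpow_mem[OF X(1) x, of i] by (auto simp: open_cover_def)
    then obtain m where m: "\<And>i. m i \<in> \<C>" "\<And>i. (f ^^ i) x \<in> m i" by metis
    let ?w = "\<lambda>s. if s = (1::real) then r else if s = -1 then l else m"
    have "\<forall>\<^sub>F y in nhds x. (y \<in> X \<and> x < y \<longrightarrow> (\<forall>i<k. (f ^^ i) y \<in> r i))
        \<and> (y \<in> X \<and> y < x \<longrightarrow> (\<forall>i<k. (f ^^ i) y \<in> l i))"
      using eventually_conj[OF r(2)[unfolded eventually_at_filter] l(2)[unfolded eventually_at_filter]]
      by (rule eventually_mono) auto
    then obtain O' where O': "open O'" "x \<in> O'"
        "\<forall>y\<in>O'. (y \<in> X \<and> x < y \<longrightarrow> (\<forall>i<k. (f ^^ i) y \<in> r i))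
          \<and> (y \<in> X \<and> y < x \<longrightarrow> (\<forall>i<k. (f ^^ i) y \<in> l i))"
      unfolding eventually_nhds by blast
    have "(f ^^ i) y \<in> ?w (sgn (y - x)) i" if y: "y \<in> X \<inter> O'" "i < k" for y i
    proof (cases y x rule: linorder_cases)
      case less
      then have "(f ^^ i) y \<in> l i" using O'(3) y by blast
      then show ?thesis using less by simp
    next
      case equal
      then show ?thesis using m(2) by simp
    next
      case greater
      then have "(f ^^ i) y \<in> r i" using O'(3) y by blast
      then show ?thesis using greater by simp
    qed
    then have "\<forall>y\<in>X \<inter> O'. \<forall>i<k. (f ^^ i) y \<in> ?w (sgn (y - x)) i" by blast
    moreover have "\<forall>s\<in>I. \<forall>i<k. ?w s i \<in> \<C>" using r(1) l(1) m(1) by simp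
    moreover have "openin (top_of_set X) (X \<inter> O')" by (rule openin_open_Int[OF O'(1)])
    moreover have "x \<in> X \<inter> O'" using O'(2) x by simp
    ultimately show "\<exists>U w. openin (top_of_set X) U \<and> x \<in> U \<and> (\<forall>s\<in>I. \<forall>i<k. w s i \<in> \<C>) \<and>
        (\<forall>y\<in>U. \<forall>i<k. (f ^^ i) y \<in> w (sgn (y - x)) i)"
      by (intro exI[of _ "X \<inter> O'"] exI[of _ ?w] conjI)
  qed
  from bchoice[OF this] obtain N where "\<forall>x\<in>X. \<exists>w. openin (top_of_set X) (N x) \<and> x \<in> N x \<and>
      (\<forall>s\<in>I. \<forall>i<k. w s i \<in> \<C>) \<and> (\<forall>y\<in>N x. \<forall>i<k. (f ^^ i) y \<in> w (sgn (y - x)) i)" ..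
  from bchoice[OF this] obtain w where "\<forall>x\<in>X. openin (top_of_set X) (N x) \<and> x \<in> N x \<and>
      (\<forall>s\<in>I. \<forall>i<k. w x s i \<in> \<C>) \<and> (\<forall>y\<in>N x. \<forall>i<k. (f ^^ i) y \<in> w x (sgn (y - x)) i)" ..
  then have Nw: "\<And>x. x \<in> X \<Longrightarrow> openin (top_of_set X) (N x)" "\<And>x. x \<in> X \<Longrightarrow> x \<in> N x"
      "\<And>x s i. \<lbrakk>x \<in> X; s \<in> I; i < k\<rbrakk> \<Longrightarrow> w x s i \<in> \<C>"
      "\<And>x y i. \<lbrakk>x \<in> X; y \<in> N x; i < k\<rbrakk> \<Longrightarrow> (f ^^ i) y \<in> w x (sgn (y - x)) i"
    by blast+
  \<comment> \<open>Different points may have the same neighbourhood, so a base point is chosen for each of them.\<close>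
  define b where "b = inv_into X N"
  have b: "b U \<in> X" "N (b U) = U" if "U \<in> N ` X" for U
    using that by (auto simp: b_def inv_into_into f_inv_into_f)
  show thesis
  proof (rule that[of "N ` X" "\<lambda>U. w (b U)"], unfold I_def[symmetric])
    have "X \<subseteq> \<Union>(N ` X)" using Nw(2) by auto
    moreover have "\<forall>C\<in>N ` X. C \<noteq> {} \<and> openin (top_of_set X) C" using Nw(1,2) by auto
    ultimately show "open_cover X (N ` X)" using X(2) by (simp add: open_cover_def)
    show "w (b U) s i \<in> \<C>" if "U \<in> N ` X" "s \<in> I" "i < k" for U s i
      by (rule Nw(3)[OF b(1)[OF that(1)] that(2,3)])
    show "\<exists>s\<in>I. \<forall>i<k. (f ^^ i) y \<in> w (b U) s i" if U: "U \<in> N ` X" "y \<in> U" for U y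
    proof (intro bexI[OF _ sgnI] allI impI)
      show "(f ^^ i) y \<in> w (b U) (sgn (y - b U)) i" if "i < k" for i
        by (rule Nw(4)[OF b(1)[OF U(1)] _ that]) (simp add: b(2)[OF U(1)] U(2))
    qed
  qed
qed

text \<open>
  The set \<open>D\<close> for \<open>f ^^ k\<close> consists of the points that hit \<open>D\<close> before time \<open>k\<close>, so \<open>f\<close> and
  \<open>f ^^ k\<close> have the same regular points.
\<close>

lemma X_tilde_funpow:
  assumes "f ` X \<subseteq> X" "k \<ge> 1"
  shows "X_tilde X (Delta_iter X D f k) (f ^^ k) = X_tilde X D f"
proof (rule set_eqI)
  fix x
  have "(\<forall>n. ((f ^^ k) ^^ n) x \<in> X - Delta_iter X D f k) \<longleftrightarrow> (\<forall>n. (f ^^ n) x \<in> X - D)" if x: "x \<in> X"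
  proof
    assume L: "\<forall>n. ((f ^^ k) ^^ n) x \<in> X - Delta_iter X D f k"
    show "\<forall>n. (f ^^ n) x \<in> X - D"
    proof
      fix n
      have "((f ^^ k) ^^ (n div k)) x \<notin> preimage X f (n mod k) D"
        using L assms(2) by (auto simp: Delta_iter_def)
      then have "(f ^^ (n mod k)) ((f ^^ (k * (n div k))) x) \<notin> D"
        using funpow_mem[OF assms(1) x] by (auto simp: preimage_def funpow_mult mult.commute)
      moreover have "(f ^^ (n mod k)) ((f ^^ (k * (n div k))) x) = (f ^^ (n mod k + k * (n div k))) x"
        by (simp only: funpow_add o_def)
      ultimately show "(f ^^ n) x \<in> X - D" using funpow_mem[OF assms(1) x] by simp
    qed
  next
    assume R: "\<forall>n. (f ^^ n) x \<in> X - D"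
    have "(f ^^ j) (((f ^^ k) ^^ n) x) \<notin> D" for n j
    proof -
      have "(f ^^ j) (((f ^^ k) ^^ n) x) = (f ^^ (j + k * n)) x"
        by (simp add: funpow_mult funpow_add mult.commute)
      then show ?thesis using R by simp
    qed
    then show "\<forall>n. ((f ^^ k) ^^ n) x \<in> X - Delta_iter X D f k"
      using funpow_mem[OF assms(1) x] by (auto simp: Delta_iter_def preimage_def funpow_mult)
  qed
  then show "x \<in> X_tilde X (Delta_iter X D f k) (f ^^ k) \<longleftrightarrow> x \<in> X_tilde X D f"
    unfolding X_tilde_iff by blast
qed

lemma htop_id:
  assumes "compact X" "X \<noteq> {}"
  shows "htop X {} id = 0"
proof -
  have T: "X_tilde X {} id = X" by (auto simp: X_tilde_iff)
  have "growth X id \<C> = 0" if C: "open_cover X \<C>" for \<C>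
  proof -
    note fin = has_finite_subcover_compact[OF assms(1) C order_refl]
    obtain \<S> where S: "finite \<S>" "\<S> \<subseteq> \<C>" "X \<subseteq> \<Union>\<S>"
      using fin unfolding has_finite_subcover_def by blast
    have le: "cyl_count X id \<C> n \<le> card \<S>" for n
    proof -
      have "(\<lambda>U. cylinder X id (\<lambda>_. U) n) ` \<S> \<subseteq> cylinders X id \<C> n"
        using S(2) by (auto simp: cylinders_def)
      moreover have "X \<subseteq> \<Union>((\<lambda>U. cylinder X id (\<lambda>_. U) n) ` \<S>)"
      proof
        fix x assume "x \<in> X"
        then obtain U where "U \<in> \<S>" "x \<in> U" using S(3) by blast
        then show "x \<in> \<Union>((\<lambda>U. cylinder X id (\<lambda>_. U) n) ` \<S>)"
          using \<open>x \<in> X\<close> by (intro UnionI[of "cylinder X id (\<lambda>_. U) n"]) (auto simp: cylinder_def)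
      qed
      ultimately have "cyl_count X id \<C> n \<le> card ((\<lambda>U. cylinder X id (\<lambda>_. U) n) ` \<S>)"
        unfolding cyl_count_def using S(1) by (intro aleph_le_card) auto
      also have "\<dots> \<le> card \<S>" by (rule card_image_le[OF S(1)])
      finally show ?thesis .
    qed
    have "growth X id \<C> \<le> 0"
    proof (rule LIMSEQ_le[OF growth_tendsto[OF fin _ assms(2)] lim_const_over_n])
      show "\<exists>N. \<forall>n\<ge>N. ln (real (cyl_count X id \<C> n)) / real n \<le> ln (real (card \<S>)) / real n"
        using le cyl_count_pos[OF fin _ assms(2), of id]
        by (intro exI[of _ 0] allI impI divide_right_mono ln_of_nat_mono) auto
    qed auto
    then show ?thesis using growth_nonneg[OF fin _ assms(2), of id] by simp
  qed
  moreover have "open_cover X {X}" using assms(2) by (auto simp: open_cover_def)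
  ultimately show ?thesis
    unfolding htop_eq_SUP_growth[OF assms(1)] T by (intro antisym SUP_least SUP_upper2[of "{X}"]) auto
qed

text \<open>
  The inequality \<open>\<le>\<close> is a count of words. For \<open>\<ge>\<close>, the three words near each point give
  \<open>k m h \<le> h' + ln 3\<close> for every \<open>m\<close>, where \<open>h\<close> is the entropy of \<open>f\<close> relative to a given cover and
  \<open>h'\<close> that of \<open>f ^^ (k * m)\<close> relative to a cover by small neighbourhoods. The latter
  is at most \<open>m\<close> times the entropy of \<open>f ^^ k\<close>, and division by \<open>m\<close> removes the error.
\<close>

lemma htop_funpow:
  assumes X: "compact X" "f ` X \<subseteq> X" "has_one_sided_limits X f" "X_tilde X D f \<noteq> {}"
  shows "htop X (Delta_iter X D f k) (f ^^ k) = ereal (real k) * htop X D f"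
proof (cases "k = 0")
  case True
  have "X \<noteq> {}" using X(4) X_tilde_subset by blast
  then show ?thesis using True htop_id[OF X(1)] by (simp add: Delta_iter_def id_def flip: zero_ereal_def)
next
  case False
  then have k: "k \<ge> 1" by simp
  let ?T = "X_tilde X D f" and ?hk = "htop X (Delta_iter X D f k) (f ^^ k)"
  note Tk = X_tilde_funpow[OF X(2) k, of D]
  note fin = has_finite_subcover_compact[OF X(1) _ X_tilde_subset[of X D f]]
  have Xne: "X \<noteq> {}" using X(4) X_tilde_subset by blast
  have inv: "(f ^^ n) ` ?T \<subseteq> ?T" for n using funpow_mem[OF X_tilde_invariant] by blast
  show ?thesis
  proof (rule antisym)
    show "?hk \<le> ereal (real k) * htop X D f"
      unfolding htop_eq_SUP_growth[OF X(1), of "Delta_iter X D f k"] Tk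
    proof (rule SUP_least)
      fix \<C> assume "\<C> \<in> {\<C>. open_cover X \<C>}"
      then have C: "open_cover X \<C>" by simp
      have "ereal (growth ?T (f ^^ k) \<C>) \<le> ereal (real k) * ereal (growth ?T f \<C>)"
        using growth_funpow_le[OF fin[OF C] X_tilde_invariant X(4) k] by simp
      also have "\<dots> \<le> ereal (real k) * htop X D f"
        by (intro ereal_mult_left_mono growth_le_htop[OF X(1) C]) auto
      finally show "ereal (growth ?T (f ^^ k) \<C>) \<le> ereal (real k) * htop X D f" .
    qed
    have key: "real k * growth ?T f \<C> \<le> r" if r: "?hk = ereal r" and C: "open_cover X \<C>" for r \<C>
    proof (rule LIMSEQ_le_const)
      show "(\<lambda>m. r + ln 3 / real m) \<longlonglongrightarrow> r"
        using tendsto_add[OF tendsto_const[of r] lim_const_over_n[of "ln 3"]] by simp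
      have "real k * growth ?T f \<C> \<le> r + ln 3 / real m" if m: "m \<ge> 1" for m
      proof -
        obtain \<U> and w :: "real set \<Rightarrow> real \<Rightarrow> nat \<Rightarrow> real set" where U: "open_cover X \<U>"
            and w: "\<And>U s i. \<lbrakk>U \<in> \<U>; s \<in> {-1, 0, 1}; i < k * m\<rbrakk> \<Longrightarrow> w U s i \<in> \<C>"
              "\<And>U y. \<lbrakk>U \<in> \<U>; y \<in> U\<rbrakk> \<Longrightarrow> \<exists>s\<in>{-1, 0, 1}. \<forall>i<k * m. (f ^^ i) y \<in> w U s i"
          using itinerary_cover[OF X(2) Xne X(3) C, of "k * m"] by metis
        have "real (k * m) * growth ?T f \<C> \<le> growth ?T (f ^^ (k * m)) \<U> + ln (real (card {-1, 0, 1::real}))"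
        proof (rule growth_funpow_ge[OF fin[OF U] fin[OF C] X_tilde_invariant X(4), where w = w])
          show "1 \<le> k * m" using k m by simp
        qed (use w in auto)
        moreover have "growth ?T (f ^^ (k * m)) \<U> \<le> real m * growth ?T (f ^^ k) \<U>"
          using growth_funpow_le[OF fin[OF U] inv X(4) m, of k] by (simp add: funpow_mult mult.commute)
        moreover have "growth ?T (f ^^ k) \<U> \<le> r"
          using growth_le_htop[OF X(1) U, of "Delta_iter X D f k" "f ^^ k"] unfolding Tk r by simp
        then have "real m * growth ?T (f ^^ k) \<U> \<le> real m * r" by (rule mult_left_mono) simp
        ultimately have "real m * (real k * growth ?T f \<C>) \<le> real m * r + ln 3"
          by (simp add: ac_simps)
        then show ?thesis using m by (simp add: field_simps)
      qed
      then show "\<exists>N. \<forall>m\<ge>N. real k * growth ?T f \<C> \<le> r + ln 3 / real m" by blast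
    qed
    have hk0: "0 \<le> ?hk" using htop_nonneg[OF X(1), of "Delta_iter X D f k"] X(4) by (simp add: Tk)
    show "ereal (real k) * htop X D f \<le> ?hk"
    proof (cases ?hk)
      case (real r)
      have "htop X D f \<le> ereal (r / real k)"
        unfolding htop_eq_SUP_growth[OF X(1)]
        using key[OF real] k by (intro SUP_least) (auto simp: field_simps)
      then have "ereal (real k) * htop X D f \<le> ereal (real k) * ereal (r / real k)"
        by (intro ereal_mult_left_mono) auto
      also have "\<dots> = ?hk" using k real by simp
      finally show ?thesis .
    qed (use hk0 in auto)
  qed
qed

section \<open>One-sided limits of pc-maps\<close>

text \<open>
  If \<open>f\<close> takes the same value at \<open>u < v\<close>, then it has an extremum strictly between them. Close to that
  point \<open>f\<close> is injective and continuous, hence strictly monotone, which an extremum excludes.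
\<close>

lemma locally_inj_imp_inj_on_interval:
  fixes f :: "real \<Rightarrow> real"
  assumes cont: "continuous_on {a<..<b} f"
    and loc: "\<And>z. z \<in> {a<..<b} \<Longrightarrow> \<exists>d>0. inj_on f ({a<..<b} \<inter> ball z d)"
  shows "inj_on f {a<..<b}"
proof (rule linorder_inj_onI')
  fix u v assume uv: "u \<in> {a<..<b}" "v \<in> {a<..<b}" "u < v"
  show "f u \<noteq> f v"
  proof
    assume eq: "f u = f v"
    have cuv: "continuous_on {u..v} f" using cont by (rule continuous_on_subset) (use uv in auto)
    have "{u..v} \<noteq> {}" using uv(3) by simp
    note attains = compact_Icc this cuv
    obtain p where p: "p \<in> {u..v}" "\<forall>y\<in>{u..v}. f y \<le> f p"
      using continuous_attains_sup[OF attains] by blast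
    obtain q where q: "q \<in> {u..v}" "\<forall>y\<in>{u..v}. f q \<le> f y"
      using continuous_attains_inf[OF attains] by blast
    \<comment> \<open>If both extrema are attained at the ends only, \<open>f\<close> is constant on the interval.\<close>
    have "\<exists>z. u < z \<and> z < v \<and> ((\<forall>y\<in>{u..v}. f y \<le> f z) \<or> (\<forall>y\<in>{u..v}. f z \<le> f y))"
    proof (cases "p \<in> {u, v} \<and> q \<in> {u, v}")
      case True
      then have "p = u \<or> p = v" "q = u \<or> q = v" by simp_all
      then have pq: "f p = f u" "f q = f u" using eq by (elim disjE; simp)+
      have const: "f y = f u" if "y \<in> {u..v}" for y
        using p(2)[rule_format, OF that] q(2)[rule_format, OF that] pq by simp
      have "(u + v) / 2 \<in> {u..v}" using uv(3) by simp
      from const[OF this] have "\<forall>y\<in>{u..v}. f y \<le> f ((u + v) / 2)"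
        by (intro ballI) (simp only: const order_refl)
      then show ?thesis using uv(3) by (intro exI[of _ "(u + v) / 2"] conjI disjI1) simp_all
    next
      case False
      then consider "p \<notin> {u, v}" | "q \<notin> {u, v}" by blast
      then show ?thesis
      proof cases
        case 1
        then have "u < p" "p < v" using p(1) by auto
        then show ?thesis using p(2) by blast
      next
        case 2
        then have "u < q" "q < v" using q(1) by auto
        then show ?thesis using q(2) by blast
      qed
    qed
    then obtain z where z: "u < z" "z < v" "(\<forall>y\<in>{u..v}. f y \<le> f z) \<or> (\<forall>y\<in>{u..v}. f z \<le> f y)"
      by blast
    obtain d where d: "d > 0" "inj_on f ({a<..<b} \<inter> ball z d)" 
    proof -
      have "z \<in> {a<..<b}" using z(1,2) uv by auto
      from loc[OF this] show thesis using that by blast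
    qed
    define e where "e = min d (min (z - u) (v - z))"
    have e: "0 < e" "e \<le> d" "e \<le> z - u" "e \<le> v - z" using d(1) z(1,2) by (simp_all add: e_def)
    let ?S = "{z - e<..<z + e}"
    have S: "?S \<subseteq> {a<..<b} \<inter> ball z d" using e uv(1,2) by (auto simp: dist_real_def abs_less_iff)
    have "continuous_on ?S f" using cont by (rule continuous_on_subset) (use S in blast)
    moreover have "inj_on f ?S" using d(2) S by (rule inj_on_subset)
    ultimately have mono: "strict_mono_on ?S f \<or> strict_antimono_on ?S f"
      using injective_eq_monotone_map[of ?S f] by (simp add: is_interval_1)
    have S3: "z - e/2 \<in> ?S" "z \<in> ?S" "z + e/2 \<in> ?S" "z - e/2 < z" "z < z + e/2"
      using e(1) by simp_all
    have uv3: "z - e/2 \<in> {u..v}" "z + e/2 \<in> {u..v}" using e by simp_all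
    from mono show False
    proof
      assume m: "strict_mono_on ?S f"
      have "f (z - e/2) < f z" "f z < f (z + e/2)"
        using monotone_onD[OF m S3(1,2,4)] monotone_onD[OF m S3(2,3,5)] .
      then show False using z(3) uv3 by (meson not_le)
    next
      assume m: "strict_antimono_on ?S f"
      have "f z < f (z - e/2)" "f (z + e/2) < f z"
        using monotone_onD[OF m S3(1,2,4)] monotone_onD[OF m S3(2,3,5)] .
      then show False using z(3) uv3 by (meson not_le)
    qed
  qed
qed

text \<open>
  Strict monotonicity makes the approach to the supremum strict, which yields the filter
  \<^term>\<open>at_left\<close> on the value side.
\<close>

lemma strict_mono_on_left_limit:
  fixes f :: "real \<Rightarrow> real"
  assumes mono: "strict_mono_on {a<..<b} f" and "a < b" and bdd: "bdd_above (f ` {a<..<b})"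
  shows "filterlim f (at_left (SUP x\<in>{a<..<b}. f x)) (at_left b)"
proof -
  define l where "l = (SUP x\<in>{a<..<b}. f x)"
  have ev: "\<forall>\<^sub>F x in at_left b. x \<in> {c<..<b}" if "c < b" for c
    using that by (rule eventually_at_left_real)
  have less: "f x < l" if x: "x \<in> {a<..<b}" for x
  proof -
    have "(x + b) / 2 \<in> {a<..<b}" "x < (x + b) / 2" using x by auto
    note m = this
    have "f x < f ((x + b) / 2)" by (rule monotone_onD[OF mono x m])
    also have "\<dots> \<le> l" unfolding l_def by (rule cSUP_upper[OF m(1) bdd])
    finally show ?thesis .
  qed
  have "(f \<longlongrightarrow> l) (at_left b)"
  proof (rule order_tendstoI)
    fix c assume "c < l"
    then obtain y where y: "y \<in> {a<..<b}" "c < f y"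
      using less_cSUP_iff[OF _ bdd, of c] \<open>a < b\<close> unfolding l_def by auto
    have "y < b" using y by simp
    from ev[OF this] show "\<forall>\<^sub>F x in at_left b. c < f x"
    proof eventually_elim
      case (elim x)
      then have "f y < f x" using y(1) by (intro monotone_onD[OF mono]) auto
      then show ?case using y(2) by simp
    qed
  next
    fix c assume c: "l < c"
    from ev[OF \<open>a < b\<close>] show "\<forall>\<^sub>F x in at_left b. f x < c"
      by eventually_elim (use less c in fastforce)
  qed
  moreover have "\<forall>\<^sub>F x in at_left b. f x \<in> {..<l} \<and> f x \<noteq> l"
    using ev[OF \<open>a < b\<close>] by eventually_elim (use less in fastforce)
  ultimately show ?thesis unfolding l_def[symmetric] filterlim_at by simp
qed

lemma inj_on_left_limit:
  fixes f :: "real \<Rightarrow> real"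
  assumes inj: "inj_on f {a<..<b}" and cont: "continuous_on {a<..<b} f" and "a < b"
    and bdd: "bounded (f ` {a<..<b})"
  shows "\<exists>l. filterlim f (at_left l) (at_left b) \<or> filterlim f (at_right l) (at_left b)"
proof -
  have "strict_mono_on {a<..<b} f \<or> strict_antimono_on {a<..<b} f"
    using injective_eq_monotone_map[OF _ cont] inj by (simp add: is_interval_1)
  then show ?thesis
  proof
    assume "strict_mono_on {a<..<b} f"
    from strict_mono_on_left_limit[OF this \<open>a < b\<close> bounded_imp_bdd_above[OF bdd]] show ?thesis by blast
  next
    assume anti: "strict_antimono_on {a<..<b} f"
    have "strict_mono_on {a<..<b} (\<lambda>x. - f x)"
      using anti by (auto simp: monotone_on_def)
    moreover have "bdd_above ((\<lambda>x. - f x) ` {a<..<b})"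
    proof -
      obtain m where "\<And>y. y \<in> f ` {a<..<b} \<Longrightarrow> m \<le> y"
        using bounded_imp_bdd_below[OF bdd] unfolding bdd_below_def by blast
      then show ?thesis by (intro bdd_aboveI2[of _ _ "- m"]) simp
    qed
    ultimately obtain l where "filterlim (\<lambda>x. - f x) (at_left l) (at_left b)"
      using strict_mono_on_left_limit[OF _ \<open>a < b\<close>] by blast
    then have lim: "((\<lambda>x. - f x) \<longlongrightarrow> l) (at_left b)"
        and ev: "\<forall>\<^sub>F x in at_left b. - f x \<in> {..<l} \<and> - f x \<noteq> l"
      unfolding filterlim_at by auto
    have "(f \<longlongrightarrow> - l) (at_left b)" using tendsto_minus[OF lim] by simp
    moreover have "\<forall>\<^sub>F x in at_left b. f x \<in> {- l<..} \<and> f x \<noteq> - l"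
      using ev by (rule eventually_mono) auto
    ultimately have "filterlim f (at_right (- l)) (at_left b)" unfolding filterlim_at by blast
    then show ?thesis by blast
  qed
qed

text \<open>
  Reflection in the origin reduces limits from the right to limits from the left.
\<close>

lemma inj_on_right_limit:
  fixes f :: "real \<Rightarrow> real"
  assumes inj: "inj_on f {a<..<b}" and cont: "continuous_on {a<..<b} f" and "a < b"
    and bdd: "bounded (f ` {a<..<b})"
  shows "\<exists>l. filterlim f (at_left l) (at_right a) \<or> filterlim f (at_right l) (at_right a)"
proof -
  have img: "uminus ` {-b<..<-a} = {a<..<b}" by simp
  have "inj_on (\<lambda>x. f (- x)) {-b<..<-a}"
    using comp_inj_on[of uminus "{-b<..<-a}" f] inj img by (simp add: o_def)
  moreover have "continuous_on {-b<..<-a} (\<lambda>x. f (- x))"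
    by (rule continuous_on_compose2[OF cont]) (auto intro: continuous_intros)
  moreover have "bounded ((\<lambda>x. f (- x)) ` {-b<..<-a})"
    using bdd img by (metis image_image)
  ultimately have "\<exists>l. filterlim (\<lambda>x. f (- x)) (at_left l) (at_left (- a))
      \<or> filterlim (\<lambda>x. f (- x)) (at_right l) (at_left (- a))"
    using \<open>a < b\<close> by (intro inj_on_left_limit) auto
  then show ?thesis unfolding at_right_minus[of a] filterlim_filtermap .
qed

lemma one_sided_limit_in:
  fixes f :: "real \<Rightarrow> real"
  assumes X: "closed X" "f ` X \<subseteq> X" and F: "F \<noteq> bot" "\<forall>\<^sub>F y in F. y \<in> X"
    and lim: "filterlim f (at_left l) F \<or> filterlim f (at_right l) F"
  shows "\<exists>l\<in>X. \<exists>G\<in>one_sided X l. filterlim f G F"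
proof -
  have evX: "\<forall>\<^sub>F y in F. f y \<in> X" using F(2) by (rule eventually_mono) (use X(2) in auto)
  have "(f \<longlongrightarrow> l) F" using lim unfolding filterlim_at by blast
  then have "l \<in> X" using Lim_in_closed_set[OF X(1) evX F(1)] by simp
  moreover have "filterlim f (at l within (X \<inter> {..<l})) F \<or> filterlim f (at l within (X \<inter> {l<..})) F"
    using lim
  proof
    assume "filterlim f (at_left l) F"
    then have "(f \<longlongrightarrow> l) F" "\<forall>\<^sub>F y in F. f y \<in> {..<l} \<and> f y \<noteq> l" by (simp_all add: filterlim_at)
    moreover from eventually_conj[OF evX this(2)]
    have "\<forall>\<^sub>F y in F. f y \<in> X \<inter> {..<l} \<and> f y \<noteq> l" by (rule eventually_mono) auto
    ultimately show ?thesis unfolding filterlim_at by blast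
  next
    assume "filterlim f (at_right l) F"
    then have "(f \<longlongrightarrow> l) F" "\<forall>\<^sub>F y in F. f y \<in> {l<..} \<and> f y \<noteq> l" by (simp_all add: filterlim_at)
    moreover from eventually_conj[OF evX this(2)]
    have "\<forall>\<^sub>F y in F. f y \<in> X \<inter> {l<..} \<and> f y \<noteq> l" by (rule eventually_mono) auto
    ultimately show ?thesis unfolding filterlim_at by blast
  qed
  ultimately show ?thesis unfolding one_sided_def by blast
qed

text \<open>
  Next to a point of \<open>X\<close>, on each side on which \<open>X\<close> continues, there is an open interval that avoids the finite set \<open>W\<close>; on it \<open>f\<close> is
  strictly monotone.
\<close>

lemma has_one_sided_limits_piecewise:
  assumes X: "X = {lo..hi}" "f ` X \<subseteq> X" and W: "finite W"
    and cont: "\<forall>x\<in>X - W. continuous (at x within X) f"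
    and inv: "\<forall>x\<in>X - W. locally_invertible_at X f x"
  shows "has_one_sided_limits X f"
proof -
  have clX: "closed X" "bounded X" using X(1) by auto
  have interval: "inj_on f {a<..<b} \<and> continuous_on {a<..<b} f \<and> bounded (f ` {a<..<b})"
    if ab: "{a<..<b} \<subseteq> X - W" for a b
  proof (intro conjI)
    show c: "continuous_on {a<..<b} f"
      unfolding continuous_on_eq_continuous_within
      using ab cont by (meson DiffD1 continuous_within_subset subset_iff)
    show "bounded (f ` {a<..<b})"
      by (rule bounded_subset[OF clX(2)]) (use ab X(2) in blast)
    show "inj_on f {a<..<b}"
    proof (rule locally_inj_imp_inj_on_interval[OF c])
      fix z assume z: "z \<in> {a<..<b}"
      then obtain U h where U: "openin (top_of_set X) U" "z \<in> U" "homeomorphism U (f ` U) f h"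
        using inv ab unfolding locally_invertible_at_def by blast
      have injU: "inj_on f U" using U(3) by (metis homeomorphism_def inj_on_def)
      obtain O' where "open O'" "U = X \<inter> O'" using U(1) by (auto simp: openin_open)
      then obtain d where d: "d > 0" "ball z d \<subseteq> O'" using U(2) openE by blast
      have "{a<..<b} \<inter> ball z d \<subseteq> U" using d(2) ab \<open>U = _\<close> by blast
      then show "\<exists>d>0. inj_on f ({a<..<b} \<inter> ball z d)" using d(1) inj_on_subset[OF injU] by blast
    qed
  qed
  show ?thesis
    unfolding has_one_sided_limits_def
  proof (intro ballI)
    fix x F assume x: "x \<in> X" and F: "F \<in> one_sided X x"
    show "\<exists>l\<in>X. \<exists>G\<in>one_sided X l. filterlim f G F"
    proof (cases "F = bot")
      case True
      then have "filterlim f F F" by (simp add: filterlim_def)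
      then show ?thesis using x F by blast
    next
      case False
      consider "F = at x within (X \<inter> {x<..})" | "F = at x within (X \<inter> {..<x})"
        using F by (auto simp: one_sided_def)
      then show ?thesis
      proof cases
        case 1
        have "x < hi"
        proof (rule ccontr)
          assume "\<not> x < hi"
          then have "X \<inter> {x<..} = {}" using X(1) by auto
          then show False using False 1 by simp
        qed
        define b where "b = Min (insert hi {w \<in> W. x < w})"
        have fin: "finite (insert hi {w \<in> W. x < w})" using W by simp
        have b: "x < b" "b \<le> hi" using fin \<open>x < hi\<close> by (auto simp: b_def)
        have "w \<ge> b" if "w \<in> W" "x < w" for w using that fin by (auto simp: b_def)
        then have "{x<..<b} \<subseteq> X - W" using b x X(1) by force
        from interval[OF this] b(1) obtain l
          where l: "filterlim f (at_left l) (at_right x) \<or> filterlim f (at_right l) (at_right x)"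
          using inj_on_right_limit by blast
        have "F \<le> at_right x" unfolding 1 by (rule at_le) auto
        then have "filterlim f (at_left l) F \<or> filterlim f (at_right l) F"
          using l filterlim_mono by blast
        moreover have "\<forall>\<^sub>F y in F. y \<in> X" unfolding 1 by (auto simp: eventually_at_filter)
        ultimately show ?thesis using one_sided_limit_in[OF clX(1) X(2) False] by blast
      next
        case 2
        have "lo < x"
        proof (rule ccontr)
          assume "\<not> lo < x"
          then have "X \<inter> {..<x} = {}" using X(1) by auto
          then show False using False 2 by simp
        qed
        define a where "a = Max (insert lo {w \<in> W. w < x})"
        have fin: "finite (insert lo {w \<in> W. w < x})" using W by simp
        have a: "a < x" "lo \<le> a" using fin \<open>lo < x\<close> by (auto simp: a_def)
        have "w \<le> a" if "w \<in> W" "w < x" for w using that fin by (auto simp: a_def)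
        then have "{a<..<x} \<subseteq> X - W" using a x X(1) by force
        from interval[OF this] a(1) obtain l
          where l: "filterlim f (at_left l) (at_left x) \<or> filterlim f (at_right l) (at_left x)"
          using inj_on_left_limit by blast
        have "F \<le> at_left x" unfolding 2 by (rule at_le) auto
        then have "filterlim f (at_left l) F \<or> filterlim f (at_right l) F"
          using l filterlim_mono by blast
        moreover have "\<forall>\<^sub>F y in F. y \<in> X" unfolding 2 by (auto simp: eventually_at_filter)
        ultimately show ?thesis using one_sided_limit_in[OF clX(1) X(2) False] by blast
      qed
    qed
  qed
qed

text \<open>
  A point in the closure of an interval but not in it lies on one side of the whole interval.
\<close>

lemma finite_closure_diff_interval:
  fixes P :: "real set"
  assumes "is_interval P" "bounded P"
  shows "finite (closure P - P)"
proof (rule finite_subset)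
  show "closure P - P \<subseteq> {Inf P, Sup P}"
  proof
    fix x assume x: "x \<in> closure P - P"
    then have ne: "P \<noteq> {}" by auto
    consider "\<forall>y\<in>P. y \<le> x" | "\<forall>y\<in>P. x \<le> y"
      using assms(1) x unfolding is_interval_1 by (metis DiffD2 linear)
    then show "x \<in> {Inf P, Sup P}"
    proof cases
      case 1
      have "P \<subseteq> {..Sup P}" using cSup_upper[OF _ bounded_imp_bdd_above[OF assms(2)]] by auto
      then have "closure P \<subseteq> {..Sup P}" by (intro closure_minimal) auto
      moreover have "Sup P \<le> x" using cSup_least[OF ne] 1 by blast
      ultimately show ?thesis using x by force
    next
      case 2
      have "P \<subseteq> {Inf P..}" using cInf_lower[OF _ bounded_imp_bdd_below[OF assms(2)]] by auto
      then have "closure P \<subseteq> {Inf P..}" by (intro closure_minimal) auto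
      moreover have "x \<le> Inf P" using cInf_greatest[OF ne] 2 by blast
      ultimately show ?thesis using x by force
    qed
  qed
qed simp

lemma Delta_eq:
  assumes "pc_map X f N P"
  shows "Delta X N P = (\<Union>i\<in>{1..N}. X \<inter> closure (P i) - P i)"
proof -
  have "top_of_set X frontier_of P i = X \<inter> closure (P i) - P i" if "i \<in> {1..N}" for i
  proof -
    have o: "openin (top_of_set X) (P i)" using assms that unfolding pc_map_def by blast
    then have "P i \<subseteq> X" by (rule openin_imp_subset)
    then have "X \<inter> P i = P i" by blast
    then show ?thesis using o
      by (simp add: frontier_of_def closure_of_subtopology interior_of_openin)
  qed
  then show ?thesis unfolding Delta_def by simp
qed

text \<open>
  This is where the finiteness of the set of critical points enters: it provides one-sided limits,
  and with them a dense set of regular points. Without regular points the entropy would be vacuous.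
\<close>

lemma pc_map_regular:
  assumes pc: "pc_map X f N P"
  shows "compact X" "X \<noteq> {}" "f ` X \<subseteq> X" "Delta X N P \<subseteq> X"
    and "\<forall>x\<in>X - Delta X N P. continuous (at x within X) f"
    and "has_one_sided_limits X f"
    and "X \<subseteq> closure (X_tilde X (Delta X N P) f)"
    and "X_tilde X (Delta X N P) f \<noteq> {}"
proof -
  let ?D = "Delta X N P"
  obtain lo hi where X: "lo < hi" "X = {lo..hi}"
    using pc by (auto simp: pc_map_def compact_interval_def)
  show cX: "compact X" and neX: "X \<noteq> {}" using X by auto
  show fX: "f ` X \<subseteq> X" using pc unfolding pc_map_def by blast
  show "?D \<subseteq> X" unfolding Delta_eq[OF pc] by blast
  have P: "is_interval (P i)" "openin (top_of_set X) (P i)" "continuous_on (P i) f"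
      "finite {x \<in> P i. critical_point X f x}" if "i \<in> {1..N}" for i
    using pc that unfolding pc_map_def by blast+
  have piece: "\<exists>i\<in>{1..N}. x \<in> P i" if x: "x \<in> X - ?D" for x
  proof -
    have "X = (\<Union>i\<in>{1..N}. closure (P i))" using pc unfolding pc_map_def by (elim conjE)
    then obtain i where "i \<in> {1..N}" "x \<in> closure (P i)" using x by blast
    then show ?thesis using x unfolding Delta_eq[OF pc] by blast
  qed
  show cont: "\<forall>x\<in>X - ?D. continuous (at x within X) f"
  proof
    fix x assume "x \<in> X - ?D"
    then obtain i where i: "i \<in> {1..N}" "x \<in> P i" using piece by blast
    obtain O' where O': "open O'" "P i = X \<inter> O'" using P(2)[OF i(1)] by (auto simp: openin_open)
    have "continuous (at x within P i) f"
      using P(3)[OF i(1)] i(2) by (simp add: continuous_on_eq_continuous_within)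
    moreover have "at x within P i = at x within X"
      using i(2) O' by (intro at_within_nhd[of x O']) auto
    ultimately show "continuous (at x within X) f" by simp
  qed
  have finD: "finite ?D"
    unfolding Delta_eq[OF pc]
  proof (intro finite_UN_I finite_atLeastAtMost)
    fix i assume i: "i \<in> {1..N}"
    have "bounded (P i)"
      using compact_imp_bounded[OF cX] openin_imp_subset[OF P(2)[OF i]] by (rule bounded_subset)
    then have "finite (closure (P i) - P i)" using finite_closure_diff_interval P(1)[OF i] by blast
    then show "finite (X \<inter> closure (P i) - P i)" by (rule rev_finite_subset) blast
  qed
  define W where "W = ?D \<union> (\<Union>i\<in>{1..N}. {x \<in> P i. critical_point X f x})"
  have "finite W" unfolding W_def using finD P(4) by auto
  moreover have "\<forall>x\<in>X - W. continuous (at x within X) f" using cont by (auto simp: W_def)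
  moreover have "\<forall>x\<in>X - W. locally_invertible_at X f x"
  proof
    fix x assume x: "x \<in> X - W"
    then obtain i where "i \<in> {1..N}" "x \<in> P i" using piece[of x] by (auto simp: W_def)
    then have "\<not> critical_point X f x" using x by (auto simp: W_def)
    then show "locally_invertible_at X f x" by (simp add: critical_point_def)
  qed
  ultimately show lim: "has_one_sided_limits X f"
    using has_one_sided_limits_piecewise[OF X(2) fX] by blast
  show dense: "X \<subseteq> closure (X_tilde X ?D f)"
  proof (rule regular_points_dense[OF cX fX lim finD])
    fix O' :: "real set" assume O': "open O'" "X \<inter> O' \<noteq> {}"
    then obtain x where x: "x \<in> X" "x \<in> O'" by blast
    obtain e where e: "0 < e" "ball x e \<subseteq> O'" using O'(1) x(2) openE by blast
    let ?I = "{max lo (x - e)<..<min hi (x + e)}"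
    have "uncountable ?I" unfolding uncountable_open_interval using x(1) X e(1) by auto
    moreover have "?I \<subseteq> X \<inter> O'" using e(2) X(2) by (auto simp: dist_real_def subset_iff)
    ultimately show "uncountable (X \<inter> O')" using countable_subset by blast
  qed
  then show "X_tilde X ?D f \<noteq> {}" using neX by auto
qed

section \<open>Conjugacy and the basic properties of entropy\<close>

lemma conjugate_imp_semi_conjugate:
  "conjugate X D f Y E g \<Longrightarrow> semi_conjugate X D f Y E g"
  unfolding conjugate_def semi_conjugate_def homeomorphism_def by blast

lemma conjugate_sym:
  assumes "conjugate X D f Y E g" "f ` X \<subseteq> X" "D \<subseteq> X" "E \<subseteq> Y"
  shows "conjugate Y E g X D f"
proof -
  obtain \<phi> \<psi> where h: "homeomorphism X Y \<phi> \<psi>" "{x \<in> X. \<phi> x \<in> E} = D"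
      "\<forall>x\<in>X - D. \<phi> (f x) = g (\<phi> x)"
    using assms(1) unfolding conjugate_def by blast
  have hom: "\<psi> y \<in> X" "\<phi> (\<psi> y) = y" if "y \<in> Y" for y
    using h(1) that unfolding homeomorphism_def by auto
  have hom': "\<psi> (\<phi> x) = x" if "x \<in> X" for x
    using h(1) that unfolding homeomorphism_def by auto
  have "{y \<in> Y. \<psi> y \<in> D} = E"
  proof (intro equalityI subsetI)
    fix y assume "y \<in> {y \<in> Y. \<psi> y \<in> D}"
    then show "y \<in> E" using h(2) hom(2)[of y] by auto
  next
    fix y assume "y \<in> E"
    then have "y \<in> Y" using assms(4) by blast
    then show "y \<in> {y \<in> Y. \<psi> y \<in> D}" using h(2) hom[of y] \<open>y \<in> E\<close> by auto
  qed
  moreover have "\<psi> (g y) = f (\<psi> y)" if y: "y \<in> Y - E" for y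
  proof -
    have p: "\<psi> y \<in> X - D" using y hom[of y] h(2) by auto
    then have "\<phi> (f (\<psi> y)) = g y" using h(3) hom(2)[of y] y by auto
    moreover have "f (\<psi> y) \<in> X" using p assms(2) by blast
    ultimately show ?thesis using hom' by metis
  qed
  ultimately show ?thesis
    unfolding conjugate_def using homeomorphism_symD[OF h(1)] by blast
qed

theorem theorem2p3:
  fixes X Y :: "real set" and f g :: "real \<Rightarrow> real"
    and N M :: nat and P Q :: "nat \<Rightarrow> real set"
  assumes "pc_map X f N P" and "pc_map Y g M Q"
  shows "(continuous_on X f \<longrightarrow> htop X (Delta X N P) f = akm_entropy X f) \<and>
    (\<forall>A. A \<noteq> {} \<and> admissible X (Delta X N P) f A \<longrightarrow>
       htop_on X (Delta X N P) f A \<le> htop X (Delta X N P) f) \<and>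
    (semi_conjugate X (Delta X N P) f Y (Delta Y M Q) g \<longrightarrow>
       htop X (Delta X N P) f \<ge> htop Y (Delta Y M Q) g) \<and>
    (conjugate X (Delta X N P) f Y (Delta Y M Q) g \<longrightarrow>
       htop X (Delta X N P) f = htop Y (Delta Y M Q) g) \<and>
    (\<forall>k::nat. htop X (Delta_iter X (Delta X N P) f k) (f ^^ k)
       = ereal (real k) * htop X (Delta X N P) f) \<and>
    (\<forall>(p::nat) (A :: nat \<Rightarrow> real set).
       X = (\<Union>i\<in>{1..p}. A i) \<and> (\<forall>i\<in>{1..p}. admissible X (Delta X N P) f (A i)) \<longrightarrow>
       htop X (Delta X N P) f = Max ((\<lambda>i. htop_on X (Delta X N P) f (A i)) ` {1..p})) \<and>
    (\<forall>\<C> :: nat \<Rightarrow> real set set.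
       (\<forall>k\<ge>1. open_cover X (\<C> k)) \<and> (\<lambda>k. cover_diam (\<C> k)) \<longlonglongrightarrow> 0 \<longrightarrow>
       (htop X (Delta X N P) f < \<infinity> \<longrightarrow>
          (\<lambda>k. ereal (htop_cover X (Delta X N P) f (\<C> k))) \<longlonglongrightarrow> htop X (Delta X N P) f) \<and>
       (htop X (Delta X N P) f = \<infinity> \<longrightarrow>
          filterlim (\<lambda>k. htop_cover X (Delta X N P) f (\<C> k)) at_top sequentially))"
proof -
  let ?D = "Delta X N P" and ?E = "Delta Y M Q"
  note X = pc_map_regular[OF assms(1)]
  note Y = pc_map_regular[OF assms(2)]
  have p1: "htop X ?D f = akm_entropy X f" if "continuous_on X f"
    by (rule htop_continuous_eq_akm[OF X(1,3,2) that X(7)])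
  have p2: "htop_on X ?D f A \<le> htop X ?D f" if "admissible X ?D f A" for A
    by (rule htop_on_le_htop[OF X(1,5) that])
  have p3: "htop Y ?E g \<le> htop X ?D f" if "semi_conjugate X ?D f Y ?E g"
    by (rule htop_semi_conjugate_le[OF X(1,3,8) Y(1) that])
  have p3': "htop X ?D f = htop Y ?E g" if c: "conjugate X ?D f Y ?E g"
  proof (rule antisym)
    show "htop X ?D f \<le> htop Y ?E g"
      by (rule htop_semi_conjugate_le[OF Y(1,3,8) X(1)
            conjugate_imp_semi_conjugate[OF conjugate_sym[OF c X(3,4) Y(4)]]])
    show "htop Y ?E g \<le> htop X ?D f" by (rule p3[OF conjugate_imp_semi_conjugate[OF c]])
  qed
  have p4: "htop X (Delta_iter X ?D f k) (f ^^ k) = ereal (real k) * htop X ?D f" for k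
    by (rule htop_funpow[OF X(1,3,6,8)])
  have p5: "htop X ?D f = Max ((\<lambda>i. htop_on X ?D f (A i)) ` {1..p})"
    if "X = (\<Union>i\<in>{1..p}. A i)" "\<forall>i\<in>{1..p}. admissible X ?D f (A i)" for p and A :: "nat \<Rightarrow> real set"
  proof (rule htop_eq_Max_htop_on[OF X(1,5) _ _ that(1)])
    show "{1..p} \<noteq> {}" using that(1) X(2) by auto
  qed (use that(2) in auto)
  have p6: "(\<lambda>k. ereal (htop_cover X ?D f (\<C> k))) \<longlonglongrightarrow> htop X ?D f"
    if "\<forall>k\<ge>1. open_cover X (\<C> k)" "(\<lambda>k. cover_diam (\<C> k)) \<longlonglongrightarrow> 0" for \<C> :: "nat \<Rightarrow> real set set"
    by (rule htop_cover_tendsto[OF X(1,8) that])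
  have p6': "filterlim (\<lambda>k. htop_cover X ?D f (\<C> k)) at_top sequentially"
    if "\<forall>k\<ge>1. open_cover X (\<C> k)" "(\<lambda>k. cover_diam (\<C> k)) \<longlonglongrightarrow> 0" "htop X ?D f = \<infinity>"
    for \<C> :: "nat \<Rightarrow> real set set"
    using p6[OF that(1,2)] unfolding that(3) tendsto_PInfty_eq_at_top .
  show ?thesis
    by (intro conjI allI impI; (elim conjE)?) (rule p4 | (rule p1 p2 p3 p3' p5 p6 p6'; assumption))+
qed

end
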